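(* Let $d,r\in\mathbb{N}$ be such that $d\le\binom{r+2}{3}$. For all $[I]\in\mathrm{Hilb}^d\mathbb{A}^3$ we have $$\dim_k T(I)\le\frac43\,\dim_k T(\mathfrak{m}^r).$$
   Context: $k$ is an infinite field, $S=k[x,y,z]$, $\mathfrak{m}=(x,y,z)$, and $\mathbb{A}^3=\mathrm{Spec}\,S$. $\mathrm{Hilb}^d\mathbb{A}^3$ is the Hilbert scheme parametrizing zero-dimensional subschemes of $\mathbb{A}^3$ of length $d$; $[I]$ denotes the $k$-point corresponding to an ideal $I\subseteq S$ with $\dim_k(S/I)=d$. $T(I)=\mathrm{Hom}_S(I,S/I)$ is the Zariski tangent space to the Hilbert scheme at $[I]$; in particular $T(\mathfrak{m}^r)=\mathrm{Hom}_S(\mathfrak{m}^r,S/\mathfrak{m}^r)$ is the tangent space at the point $[\mathfrak{m}^r]$ of $\mathrm{Hilb}^{\binom{r+2}{3}}\mathbb{A}^3$. *)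

theory Defs
  imports
    "HOL-Library.Poly_Mapping"
    "HOL-Library.Numeral_Type"
    "HOL-Algebra.Ideal_Product"
    "HOL-Algebra.QuotRing"
    "Jordan_Normal_Form.VS_Connect"
begin

section \<open>Modules attached to a commutative ring\<close>

text \<open>
  The \<open>mult\<close> and \<open>one\<close> fields of a record of type \<open>module\<close> play no role in the locale
  \<open>module\<close>.
\<close>

definition ideal_module :: "('a, 'b) ring_scheme \<Rightarrow> 'a set \<Rightarrow> ('a, 'a) module" where
  "ideal_module R I =
     \<lparr>carrier = I, mult = mult R, one = one R, zero = zero R, add = add R, smult = mult R\<rparr>"

definition quotient_module :: "('a, 'b) ring_scheme \<Rightarrow> 'a set \<Rightarrow> ('a, 'a set) module" where
  "quotient_module R I =
     \<lparr>carrier = carrier (R Quot I), mult = mult (R Quot I), one = one (R Quot I),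
      zero = zero (R Quot I), add = add (R Quot I),
      smult = (\<lambda>a C. (I +>\<^bsub>R\<^esub> a) \<otimes>\<^bsub>R Quot I\<^esub> C)\<rparr>"

text \<open>
  The set \<open>LinearCombinations.module_hom R M N\<close> does not fix the values of a map outside of the carrier of \<open>M\<close>;
  intersecting with \<open>extensional\<close> makes every homomorphism be represented exactly once.
\<close>

definition hom_module ::
  "('r, 'a) ring_scheme \<Rightarrow> ('r, 'm, 'b) module_scheme \<Rightarrow> ('r, 'n, 'c) module_scheme \<Rightarrow>
     ('r, 'm \<Rightarrow> 'n) module" where
  "hom_module R M N =
     \<lparr>carrier = LinearCombinations.module_hom R M N \<inter> extensional (carrier M),
      mult = (\<lambda>f g. \<lambda>m\<in>carrier M. \<zero>\<^bsub>N\<^esub>), one = (\<lambda>m\<in>carrier M. \<zero>\<^bsub>N\<^esub>),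
      zero = (\<lambda>m\<in>carrier M. \<zero>\<^bsub>N\<^esub>),
      add = (\<lambda>f g. \<lambda>m\<in>carrier M. f m \<oplus>\<^bsub>N\<^esub> g m),
      smult = (\<lambda>a f. \<lambda>m\<in>carrier M. a \<odot>\<^bsub>N\<^esub> f m)\<rparr>"

definition restrict_scalars ::
  "('k \<Rightarrow> 'r) \<Rightarrow> ('r, 'm, 'b) module_scheme \<Rightarrow> ('k, 'm) module" where
  "restrict_scalars h M =
     \<lparr>carrier = carrier M, mult = mult M, one = one M, zero = zero M, add = add M,
      smult = (\<lambda>c v. h c \<odot>\<^bsub>M\<^esub> v)\<rparr>"

lemma module_ideal_module:
  fixes R (structure)
  assumes "cring R" "ideal I R"
  shows "module R (ideal_module R I)"
proof -
  interpret cring R by fact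
  interpret I: ideal I R by fact
  note sub = I.Icarr
  show ?thesis
  proof (rule moduleI)
    show "abelian_group (ideal_module R I)"
    proof (rule abelian_groupI)
      fix x assume "x \<in> carrier (ideal_module R I)"
      then have x: "x \<in> I" by (simp add: ideal_module_def)
      then have "\<ominus> x \<in> I" "\<ominus> x \<oplus> x = \<zero>" by (auto simp: sub l_neg)
      then show "\<exists>y\<in>carrier (ideal_module R I). y \<oplus>\<^bsub>ideal_module R I\<^esub> x = \<zero>\<^bsub>ideal_module R I\<^esub>"
        by (auto simp: ideal_module_def)
    qed (auto simp: ideal_module_def sub a_ac)
  qed (auto simp: ideal_module_def sub I.I_l_closed l_distr r_distr m_assoc is_cring)
qed

lemma module_quotient_module:
  fixes R (structure)
  assumes "cring R" "ideal I R"
  shows "module R (quotient_module R I)"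
proof -
  interpret cring R by fact
  interpret I: ideal I R by fact
  interpret Q: cring "R Quot I"
    by (rule I.quotient_is_cring[OF is_cring])
  interpret h: ring_hom_ring R "R Quot I" "(+>) I"
    by (rule I.rcos_ring_hom_ring)
  have one: "(I +> \<one>) \<otimes>\<^bsub>R Quot I\<^esub> x = x" if "x \<in> carrier (R Quot I)" for x
    using Q.l_one[OF that] h.hom_one by metis
  show ?thesis
  proof (rule moduleI)
    show "abelian_group (quotient_module R I)"
    proof (rule abelian_groupI)
      fix x assume "x \<in> carrier (quotient_module R I)"
      then have x: "x \<in> carrier (R Quot I)" by (simp add: quotient_module_def)
      then show "\<exists>y\<in>carrier (quotient_module R I).
          y \<oplus>\<^bsub>quotient_module R I\<^esub> x = \<zero>\<^bsub>quotient_module R I\<^esub>"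
        using Q.l_neg[OF x] Q.a_inv_closed[OF x] by (auto simp: quotient_module_def)
    qed (auto simp: quotient_module_def Q.a_ac)
  qed (auto simp: quotient_module_def Q.l_distr Q.r_distr Q.m_assoc is_cring one)
qed

lemma module_hom_module:
  assumes "module R M" "module R N"
  shows "module R (hom_module R M N)"
proof -
  interpret M: Module.module R M by fact
  interpret N: Module.module R N by fact
  let ?H = "hom_module R M N"
  note defs = hom_module_def LinearCombinations.module_hom_def Pi_iff
  have eqI: "f = g" if "f \<in> extensional (carrier M)" "g \<in> extensional (carrier M)"
    "\<And>m. m \<in> carrier M \<Longrightarrow> f m = g m" for f g
    using that by (rule extensionalityI)
  show ?thesis
  proof (rule moduleI)
    show "abelian_group ?H"
    proof (rule abelian_groupI)
      fix f assume f: "f \<in> carrier ?H"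
      let ?g = "\<lambda>m\<in>carrier M. \<ominus>\<^bsub>N\<^esub> f m"
      have "?g \<in> carrier ?H" 
        using f by (auto simp: defs N.minus_add N.smult_r_minus)
      moreover have "?g \<oplus>\<^bsub>?H\<^esub> f = \<zero>\<^bsub>?H\<^esub>"
        using f by (auto simp: defs N.l_neg intro!: restrict_ext)
      ultimately show "\<exists>g\<in>carrier ?H. g \<oplus>\<^bsub>?H\<^esub> f = \<zero>\<^bsub>?H\<^esub>" by blast
    next
      fix f g assume "f \<in> carrier ?H" "g \<in> carrier ?H"
      then show "f \<oplus>\<^bsub>?H\<^esub> g \<in> carrier ?H"
        by (auto simp: defs N.a_ac N.smult_r_distr)
    qed (auto simp: defs N.a_ac intro!: restrict_ext eqI)
  next
    fix a f assume "a \<in> carrier R" "f \<in> carrier ?H"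
    then show "a \<odot>\<^bsub>?H\<^esub> f \<in> carrier ?H"
      by (auto simp: defs N.smult_r_distr N.smult_assoc1[symmetric] M.R.m_comm)
  qed (auto simp: defs N.smult_l_distr N.smult_r_distr N.smult_assoc1 M.R.is_cring
         intro!: restrict_ext eqI)
qed

lemma module_restrict_scalars:
  assumes "module R M" "cring K" "h \<in> Ring.ring_hom K R"
  shows "module K (restrict_scalars h M)"
proof -
  interpret M: Module.module R M by fact
  interpret K: cring K by fact
  interpret h: ring_hom_cring K R h
    by unfold_locales (rule assms)
  show ?thesis
  proof (rule moduleI)
    show "abelian_group (restrict_scalars h M)"
    proof (rule abelian_groupI)
      fix x assume "x \<in> carrier (restrict_scalars h M)"
      then have x: "x \<in> carrier M" by (simp add: restrict_scalars_def)
      then show "\<exists>y\<in>carrier (restrict_scalars h M).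
          y \<oplus>\<^bsub>restrict_scalars h M\<^esub> x = \<zero>\<^bsub>restrict_scalars h M\<^esub>"
        using M.l_neg[OF x] M.a_inv_closed[OF x] by (auto simp: restrict_scalars_def)
    qed (auto simp: restrict_scalars_def M.a_ac)
  qed (auto simp: restrict_scalars_def M.smult_l_distr M.smult_r_distr M.smult_assoc1 K.is_cring)
qed


section \<open>Points of the Hilbert scheme of affine three-space and their tangent spaces\<close>

text \<open>
  The polynomial ring in three variables: exponent vectors are functions from the
  three-element type \<open>3\<close>, whose elements are \<open>0\<close>, \<open>1\<close>, \<open>2\<close>, to the natural numbers.
\<close>

type_synonym 'k poly3 = "(3 \<Rightarrow>\<^sub>0 nat) \<Rightarrow>\<^sub>0 'k"

abbreviation poly3_ring :: "'k::field poly3 ring" where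
  "poly3_ring \<equiv> class_ring"

definition const3 :: "'k::field \<Rightarrow> 'k poly3" where
  "const3 c = Poly_Mapping.single 0 c"

definition var3 :: "3 \<Rightarrow> 'k::field poly3" where
  "var3 i = Poly_Mapping.single (Poly_Mapping.single i 1) 1"

definition max_ideal3 :: "'k::field poly3 set" where
  "max_ideal3 = Idl\<^bsub>poly3_ring\<^esub> {var3 0, var3 1, var3 2}"

text \<open>The power is taken in the multiplicative monoid of ideals, with product \<open>ideal_prod\<close>.\<close>

definition max_ideal3_power :: "nat \<Rightarrow> 'k::field poly3 set" where
  "max_ideal3_power r = max_ideal3 [^]\<^bsub>ideals_set poly3_ring\<^esub> r"

definition quotient_space3 :: "'k::field poly3 set \<Rightarrow> ('k, 'k poly3 set) module" where
  "quotient_space3 I = restrict_scalars const3 (quotient_module poly3_ring I)"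

text \<open>
  The \<open>k\<close>-points of the Hilbert scheme of \<open>d\<close> points, given by ideals of colength \<open>d\<close>.
  \<open>fin_dim\<close> is required since \<open>dim\<close> is an unspecified number on infinite-dimensional spaces.
\<close>

definition Hilb3 :: "nat \<Rightarrow> 'k::field poly3 set set" where
  "Hilb3 d = {I. ideal I poly3_ring \<and>
     vectorspace.fin_dim class_ring (quotient_space3 I) \<and>
     vectorspace.dim class_ring (quotient_space3 I) = d}"

definition tangent_space3 :: "'k::field poly3 set \<Rightarrow> ('k, 'k poly3 \<Rightarrow> 'k poly3 set) module" where
  "tangent_space3 I = restrict_scalars const3
     (hom_module poly3_ring (ideal_module poly3_ring I) (quotient_module poly3_ring I))"

lemma cring_class_ring: "cring (class_ring :: 'a::comm_ring_1 ring)"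
  by unfold_locales

lemma field_class_ring: "field (class_ring :: 'a::field ring)"
  by unfold_locales

lemma const3_hom: "const3 \<in> Ring.ring_hom class_ring poly3_ring"
  by (rule ring_hom_memI) (auto simp: const3_def single_add mult_single)

lemma vectorspace_quotient_space3:
  assumes "ideal I poly3_ring"
  shows "vectorspace class_ring (quotient_space3 I)"
  unfolding quotient_space3_def vectorspace_def
  by (intro conjI field_class_ring module_restrict_scalars[OF _ cring_class_ring const3_hom]
      module_quotient_module cring_class_ring assms)

lemma vectorspace_tangent_space3:
  assumes "ideal I poly3_ring"
  shows "vectorspace class_ring (tangent_space3 I)"
  unfolding tangent_space3_def vectorspace_def
  by (intro conjI field_class_ring module_restrict_scalars[OF _ cring_class_ring const3_hom]
      module_hom_module module_ideal_module module_quotient_module cring_class_ring assms)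

lemma ideal_max_ideal3_power: "ideal (max_ideal3_power r) poly3_ring"
proof -
  interpret P: comm_monoid "ideals_set (poly3_ring :: 'a poly3 ring)"
    by (rule cring.ideals_set_is_comm_monoid[OF cring_class_ring])
  have "max_ideal3 \<in> carrier (ideals_set (poly3_ring :: 'a poly3 ring))"
    unfolding max_ideal3_def ideals_set_def
    by (auto intro!: ring.genideal_ideal cring.axioms(1) cring_class_ring)
  from P.nat_pow_closed[OF this, of r] show ?thesis
    by (simp add: max_ideal3_power_def ideals_set_def)
qed

end

theory Submission
  imports Defs "HOL-Library.Function_Algebras" "HOL-Computational_Algebra.Polynomial"
begin

text \<open>
  Let \<open>S = k[x, y, z]\<close> and \<open>M = S/I\<close>, of dimension \<open>d\<close>. Extending homomorphisms from \<open>I\<close> to \<open>M\<close>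
  linearly to \<open>S\<close> and taking commutators with the variables identifies the tangent space with
  \<open>Ext\<^sup>1\<^sub>S(M, M)\<close>, the triples \<open>(A, B, C)\<close> of matrices with \<open>[x, B] = [y, A]\<close> and so on, modulo the
  triples \<open>([x, U], [y, U], [z, U])\<close>. An endomorphism commuting with \<open>x, y, z\<close> is determined by its
  value at \<open>1\<close>, so the latter triples form a space of dimension at least \<open>d\<^sup>2 - d\<close>. Let \<open>c\<close> be the
  dimension of the space of endomorphisms commuting with \<open>x\<close> and \<open>y\<close>. By duality for the trace form
  the map \<open>(A, B) \<mapsto> [x, B] - [y, A]\<close> has rank at least \<open>d\<^sup>2 - c\<close>, so its kernel has dimension at most
  \<open>d\<^sup>2 + c\<close>; given \<open>(A, B)\<close>, the third component \<open>C\<close> is determined up to the commutant of \<open>x\<close> and \<open>y\<close>.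
  Hence \<open>dim T(I) \<le> d + 2c\<close>.

  If \<open>d < (r + 3) choose 3\<close>, then \<open>I\<close> contains a nonzero polynomial of degree \<open>s \<le> r\<close>. After a linear change of
  coordinates, possible because \<open>k\<close> is infinite, it is monic in \<open>z\<close>, so \<open>M\<close> is generated by
  \<open>1, z, \<dots>, z\<^bsup>s-1\<^esup>\<close> over \<open>k[x, y]\<close> and \<open>c \<le> s d\<close>. This gives \<open>dim T(I) \<le> (2 r + 1) d\<close>, and the
  claim follows from \<open>dim T(m\<^sup>r) \<ge> ((r + 2) choose 2) * ((r + 1) choose 2)\<close>.
\<close>

section \<open>Dimensions of finite-dimensional subspaces\<close>

text \<open>\<open>dim\<close> is the \<open>card\<close> of a basis, hence 0 for an infinite one;
  the finite set \<open>F\<close> rules this out.\<close>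

lemma (in vector_space) dim_mono_finite:
  assumes "U \<subseteq> V" "V \<subseteq> span F" "finite F"
  shows "dim U \<le> dim V"
proof -
  obtain B where B: "B \<subseteq> V" "independent B" "V \<subseteq> span B" "card B = dim V"
    using basis_exists by blast
  have "finite B"
    using independent_span_bound[OF assms(3) B(2)] B(1) assms(2) by blast
  moreover have "U \<subseteq> span B" using B(3) assms(1) by blast
  ultimately show ?thesis using dim_le_card B(4) by metis
qed

text \<open>A vector in both spans has its unique coefficients supported on \<open>B\<close> and
  also on \<open>C\<close>, hence nowhere.\<close>

lemma (in vector_space) span_Int_span_disjoint:
  assumes "independent (B \<union> C)" "B \<inter> C = {}"
  shows "span B \<inter> span C = {0}"
proof -
  have "v = 0" if v: "v \<in> span B" "v \<in> span C" for v
  proof -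
    have "representation (B \<union> C) v = representation B v"
      using representation_extend[OF assms(1) v(1)] by blast
    moreover have "representation (B \<union> C) v = representation C v"
      using representation_extend[OF assms(1) v(2)] by blast
    ultimately have eq: "representation B v = representation C v" by simp
    have "representation B v b = 0" for b
      using representation_ne_zero[of B v b] representation_ne_zero[of C v b] eq assms(2) by auto
    then show "v = 0"
      using sum_nonzero_representation_eq[OF _ v(1)] independent_mono[OF assms(1), of B] by auto
  qed
  then show ?thesis by (auto simp: span_zero)
qed

text \<open>Bases of \<open>U\<close> and \<open>V\<close> are independent together. This later
  separates tangent vectors from coboundaries inside the space of cocycles.\<close>

lemma (in vector_space) dim_sum_disjoint:
  assumes "subspace U" "subspace V" "U \<inter> V \<subseteq> {0}" "U \<subseteq> W" "V \<subseteq> W" "W \<subseteq> span F" "finite F"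
  shows "dim U + dim V \<le> dim W"
proof -
  obtain B where B: "B \<subseteq> U" "independent B" "U \<subseteq> span B" "card B = dim U"
    using basis_exists by blast
  obtain B' where B': "B' \<subseteq> V" "independent B'" "V \<subseteq> span B'" "card B' = dim V"
    using basis_exists by blast
  have fin: "finite B" "finite B'"
    using independent_span_bound[OF assms(7) B(2)] independent_span_bound[OF assms(7) B'(2)]
      B(1) B'(1) assms(4,5,6) by blast+
  have 0: "0 \<notin> B" "0 \<notin> B'" using dependent_zero B(2) B'(2) by blast+
  have "independent (B \<union> B')"
  proof (rule independent_if_scalars_zero)
    show "finite (B \<union> B')" using fin by simp
    fix f x assume s: "(\<Sum>x\<in>B \<union> B'. scale (f x) x) = 0" and x: "x \<in> B \<union> B'"
    have disj: "B \<inter> B' = {}" using B(1) B'(1) assms(3) 0 by blast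
    have "(\<Sum>x\<in>B. scale (f x) x) + (\<Sum>x\<in>B'. scale (f x) x) = 0"
      using s sum.union_disjoint[OF fin disj] by metis
    moreover have 1: "(\<Sum>x\<in>B. scale (f x) x) \<in> U" "(\<Sum>x\<in>B'. scale (f x) x) \<in> V"
      using B(1) B'(1) assms(1,2) by (auto intro!: subspace_sum subspace_scale)
    ultimately have "(\<Sum>x\<in>B'. scale (f x) x) = - (\<Sum>x\<in>B. scale (f x) x)"
      by (simp add: add_eq_0_iff)
    then have "(\<Sum>x\<in>B'. scale (f x) x) = 0"
      using 1 subspace_neg[OF assms(1) 1(1)] assms(3) by auto
    moreover from this have "(\<Sum>x\<in>B. scale (f x) x) = 0"
      using \<open>_ + _ = 0\<close> by simp
    ultimately show "f x = 0"
      using x independentD[OF B(2) fin(1) subset_refl] independentD[OF B'(2) fin(2) subset_refl] by blast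
  qed
  then have "card (B \<union> B') = dim (B \<union> B')"
    by (simp add: dim_eq_card_independent)
  also have "\<dots> \<le> dim W"
    by (rule dim_mono_finite[OF _ assms(6,7)]) (use B(1) B'(1) assms(4,5) in blast)
  also have "card (B \<union> B') = card B + card B'"
    using fin B(1) B'(1) assms(3) 0 by (intro card_Un_disjoint) blast+
  finally show ?thesis using B(4) B'(4) by simp
qed

lemma (in vector_space_pair) dim_image_inj:
  assumes f: "Vector_Spaces.linear s1 s2 f" and U: "vs1.subspace U" and inj: "\<And>u. u \<in> U \<Longrightarrow> f u = 0 \<Longrightarrow> u = 0"
  shows "vs2.dim (f ` U) = vs1.dim U"
proof -
  interpret f: Vector_Spaces.linear s1 s2 f by fact
  have i: "inj_on f U" using f.inj_on_iff_eq_0[OF U] inj by blast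
  obtain B where B: "B \<subseteq> U" "vs1.independent B" "U \<subseteq> vs1.span B" "card B = vs1.dim U"
    using vs1.basis_exists by blast
  have sp: "vs1.span B = U" using B U by (metis vs1.span_minimal subset_antisym)
  have "vs2.independent (f ` B)"
    using f.independent_inj_on_image[OF B(2)] i sp by simp
  moreover have "f ` U = vs2.span (f ` B)" using f.span_image sp by simp
  ultimately have "vs2.dim (f ` U) = card (f ` B)"
    by (simp add: vs2.dim_eq_card_independent)
  then show ?thesis using B(4) card_image[OF inj_on_subset[OF i B(1)]] by simp
qed

text \<open>Rank-nullity on a subspace: a basis \<open>B\<close> of the kernel extends to a basis
  \<open>C\<close> of \<open>U\<close>, and the span of \<open>C - B\<close> maps isomorphically
  onto the image.\<close>

lemma (in vector_space_pair) dim_image_kernel: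
  assumes f: "Vector_Spaces.linear s1 s2 f" and U: "vs1.subspace U" "U \<subseteq> vs1.span F" "finite F"
  shows "vs1.dim U = vs2.dim (f ` U) + vs1.dim {u \<in> U. f u = 0}"
proof -
  let ?K = "{u \<in> U. f u = 0}"
  interpret f: Vector_Spaces.linear s1 s2 f by fact
  obtain B where B: "B \<subseteq> ?K" "vs1.independent B" "?K \<subseteq> vs1.span B" "card B = vs1.dim ?K"
    using vs1.basis_exists by blast
  obtain C where C: "B \<subseteq> C" "C \<subseteq> U" "vs1.independent C" "U \<subseteq> vs1.span C"
    using vs1.maximal_independent_subset_extend[of B U] B by blast
  have fin: "finite C" using vs1.independent_span_bound[OF U(3) C(3)] C(2) U(2) by blast
  have cC: "card C = vs1.dim U" using vs1.basis_card_eq_dim C by blast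
  have CB: "C = B \<union> (C - B)" using C(1) by blast
  have spB: "vs1.span B \<inter> vs1.span (C - B) = {0}"
    using vs1.span_Int_span_disjoint[of B "C - B"] CB C(3) by simp
  have spC: "vs1.span (C - B) \<subseteq> U" by (rule vs1.span_minimal) (use C(2) U(1) in auto)
  have z: "u = 0" if "u \<in> vs1.span (C - B)" "f u = 0" for u
    using that spC spB B(3) by auto
  have "vs2.dim (f ` vs1.span (C - B)) = card (C - B)"
    using dim_image_inj[OF f vs1.subspace_span z] vs1.independent_mono[OF C(3), of "C - B"]
    by (simp add: vs1.dim_eq_card_independent)
  moreover have "f ` vs1.span (C - B) = f ` U"
  proof
    show "f ` U \<subseteq> f ` vs1.span (C - B)"
    proof (clarify)
      fix u assume "u \<in> U"
      then have "u \<in> vs1.span (B \<union> (C - B))" using C(4) CB by auto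
      then obtain a b where u: "u = a + b" "a \<in> vs1.span B" "b \<in> vs1.span (C - B)"
        unfolding vs1.span_Un by blast
      have "f a = 0" using f.eq_0_on_span[of B a] B(1) u(2) by auto
      then have "f u = f b" using u(1) f.add by simp
      then show "f u \<in> f ` vs1.span (C - B)" using u(3) by blast
    qed
  qed (use spC in blast)
  moreover have "card C = card (C - B) + card B"
    using fin C(1) by (metis card_Diff_subset card_mono finite_subset le_add_diff_inverse2)
  ultimately show ?thesis using cC B(4) by simp
qed

section \<open>Coordinate spaces of functions\<close>

definition fscale :: "'k::field \<Rightarrow> ('j \<Rightarrow> 'k) \<Rightarrow> 'j \<Rightarrow> 'k" where
  "fscale c f = (\<lambda>j. c * f j)"

lemma fscale_apply [simp]: "fscale c f j = c * f j"
  by (simp add: fscale_def)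

global_interpretation fs: vector_space fscale
  by unfold_locales (auto simp: fun_eq_iff algebra_simps)

global_interpretation fsp: vector_space_pair fscale fscale
  by unfold_locales

text \<open>Coordinates are indexed by sets rather than types because a basis of the quotient
  depends on the ideal; vanishing off \<open>\<Omega>\<close> keeps the space finite-dimensional for
  finite \<open>\<Omega>\<close>.\<close>

definition fspace :: "'j set \<Rightarrow> ('j \<Rightarrow> 'k::field) set" where
  "fspace \<Omega> = {f. \<forall>x. x \<notin> \<Omega> \<longrightarrow> f x = 0}"

lemma subspace_fspace: "fs.subspace (fspace \<Omega>)"
  by (auto simp: fspace_def fs.subspace_def)

lemma fspace_eq_0I:
  assumes "f \<in> fspace \<Omega>" "\<And>x. x \<in> \<Omega> \<Longrightarrow> f x = 0"
  shows "f = 0"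
proof
  fix x show "f x = 0 x" using assms by (cases "x \<in> \<Omega>") (simp_all add: fspace_def)
qed

lemma sum_fun_apply: "(\<Sum>i\<in>A. f i) x = (\<Sum>i\<in>A. f i x)"
  by (induction A rule: infinite_finite_induct) auto

definition funit :: "'j \<Rightarrow> 'j \<Rightarrow> 'k::field" where
  "funit j = (\<lambda>i. if i = j then 1 else 0)"

lemma fspace_expand:
  assumes "finite \<Omega>" "f \<in> fspace \<Omega>"
  shows "f = (\<Sum>j\<in>\<Omega>. fscale (f j) (funit j))"
proof
  fix i
  have "(\<Sum>j\<in>\<Omega>. fscale (f j) (funit j)) i = (\<Sum>j\<in>\<Omega>. if i = j then f j else 0)"
    unfolding sum_fun_apply by (intro sum.cong) (auto simp: funit_def)
  also have "\<dots> = f i" using assms by (auto simp: fspace_def)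
  finally show "f i = (\<Sum>j\<in>\<Omega>. fscale (f j) (funit j)) i" by simp
qed

lemma inj_funit: "inj (funit :: 'j \<Rightarrow> 'j \<Rightarrow> 'k::field)"
proof (rule injI)
  fix x y :: 'j
  assume "(funit x :: 'j \<Rightarrow> 'k) = funit y"
  then have "(funit x :: 'j \<Rightarrow> 'k) x = funit y x" by simp
  then show "x = y" by (simp add: funit_def split: if_splits)
qed

lemma fspace_span:
  assumes "finite \<Omega>"
  shows "fspace \<Omega> \<subseteq> fs.span (funit ` \<Omega>)"
proof
  fix f :: "'a \<Rightarrow> 'b" assume "f \<in> fspace \<Omega>"
  then have "f = (\<Sum>j\<in>\<Omega>. fscale (f j) (funit j))" using fspace_expand assms by blast
  also have "\<dots> \<in> fs.span (funit ` \<Omega>)" by (intro fs.span_sum fs.span_scale fs.span_base) auto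
  finally show "f \<in> fs.span (funit ` \<Omega>)" .
qed

lemma dim_fspace:
  assumes "finite \<Omega>"
  shows "fs.dim (fspace \<Omega> :: ('j \<Rightarrow> 'k::field) set) = card \<Omega>"
proof -
  let ?F = "funit ` \<Omega> :: ('j \<Rightarrow> 'k) set"
  have "fs.independent ?F"
  proof (rule fs.independent_if_scalars_zero)
    fix f :: "('j \<Rightarrow> 'k) \<Rightarrow> 'k" and x
    assume 0: "(\<Sum>x\<in>?F. fscale (f x) x) = 0" and "x \<in> ?F"
    then obtain j where j: "j \<in> \<Omega>" "x = funit j" by blast
    have "(\<Sum>x\<in>?F. fscale (f x) x) j = (\<Sum>i\<in>\<Omega>. f (funit i) * funit i j)"
      by (simp add: sum_fun_apply sum.reindex inj_on_subset[OF inj_funit])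
    also have "\<dots> = (\<Sum>i\<in>\<Omega>. if i = j then f (funit i) else 0)"
      by (intro sum.cong) (auto simp: funit_def)
    also have "\<dots> = f (funit j)" using j(1) assms by simp
    finally show "f x = 0" using 0 j by simp
  qed (use assms in simp)
  then have "fs.dim (fspace \<Omega> :: ('j \<Rightarrow> 'k) set) = card ?F"
    by (intro fs.dim_unique[OF _ fspace_span[OF assms]]) (auto simp: fspace_def funit_def)
  then show ?thesis by (simp add: card_image inj_on_subset[OF inj_funit])
qed

lemma fs_dim_mono: "U \<subseteq> V \<Longrightarrow> V \<subseteq> fspace \<Omega> \<Longrightarrow> finite \<Omega> \<Longrightarrow> fs.dim U \<le> fs.dim V"
  by (rule fs.dim_mono_finite[of _ _ "funit ` \<Omega>"]) (auto dest: subsetD[OF fspace_span])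

lemma fs_dim_le_card: "U \<subseteq> fspace \<Omega> \<Longrightarrow> finite \<Omega> \<Longrightarrow> fs.dim U \<le> card \<Omega>"
  by (metis fs_dim_mono[OF _ subset_refl] dim_fspace)

lemma fs_dim_image_kernel:
  assumes "Vector_Spaces.linear fscale fscale f" "fs.subspace U" "U \<subseteq> fspace \<Omega>" "finite \<Omega>"
  shows "fs.dim U = fs.dim (f ` U) + fs.dim {u \<in> U. f u = 0}"
  by (rule fsp.dim_image_kernel[OF assms(1,2) order_trans[OF assms(3) fspace_span[OF assms(4)]]])
    (simp add: assms(4))

text \<open>Most of the dimension bounds below come from a linear map, such as evaluation at test
  vectors, that is injective on \<open>U\<close>.\<close>

lemma fs_dim_le_inj:
  assumes "Vector_Spaces.linear fscale fscale f" "fs.subspace U"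
    and "\<And>u. u \<in> U \<Longrightarrow> f u = 0 \<Longrightarrow> u = 0" "f ` U \<subseteq> V" "V \<subseteq> fspace \<Omega>" "finite \<Omega>"
  shows "fs.dim U \<le> fs.dim V"
  using fsp.dim_image_inj[OF assms(1-3)] fs_dim_mono[OF assms(4-6)] by simp

lemma fs_linearI:
  assumes "\<And>u v. f (u + v) = f u + f v" "\<And>c u. f (fscale c u) = fscale c (f u)"
  shows "Vector_Spaces.linear fscale fscale f"
  by unfold_locales (use assms in auto)

section \<open>Matrices\<close>

definition mtimes :: "'i set \<Rightarrow> ('i \<times> 'i \<Rightarrow> 'k::field) \<Rightarrow> ('i \<times> 'i \<Rightarrow> 'k) \<Rightarrow> 'i \<times> 'i \<Rightarrow> 'k" where
  "mtimes B P Q = (\<lambda>(i, j). \<Sum>k\<in>B. P (i, k) * Q (k, j))"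

definition mapply :: "'i set \<Rightarrow> ('i \<times> 'i \<Rightarrow> 'k::field) \<Rightarrow> ('i \<Rightarrow> 'k) \<Rightarrow> 'i \<Rightarrow> 'k" where
  "mapply B P v = (\<lambda>i. \<Sum>k\<in>B. P (i, k) * v k)"

definition bracket :: "'i set \<Rightarrow> ('i \<times> 'i \<Rightarrow> 'k::field) \<Rightarrow> ('i \<times> 'i \<Rightarrow> 'k) \<Rightarrow> 'i \<times> 'i \<Rightarrow> 'k" where
  "bracket B P Q = mtimes B P Q - mtimes B Q P"

definition mtrace :: "'i set \<Rightarrow> ('i \<times> 'i \<Rightarrow> 'k::field) \<Rightarrow> 'k" where
  "mtrace B P = (\<Sum>i\<in>B. P (i, i))"

lemma mtimes_assoc: "mtimes B (mtimes B P Q) R = mtimes B P (mtimes B Q R)"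
proof (rule ext, clarify)
  fix i j
  show "mtimes B (mtimes B P Q) R (i, j) = mtimes B P (mtimes B Q R) (i, j)"
    unfolding mtimes_def split sum_distrib_left sum_distrib_right
    by (subst sum.swap) (simp add: mult.assoc)
qed

lemma mapply_mtimes: "mapply B (mtimes B P Q) v = mapply B P (mapply B Q v)"
proof
  fix i
  show "mapply B (mtimes B P Q) v i = mapply B P (mapply B Q v) i"
    unfolding mtimes_def mapply_def split sum_distrib_left sum_distrib_right
    by (subst sum.swap) (simp add: mult.assoc)
qed

lemma mtrace_commute: "mtrace B (mtimes B P Q) = mtrace B (mtimes B Q P)"
  by (simp add: mtrace_def mtimes_def) (subst sum.swap, simp add: mult.commute)

lemma mtrace_add [simp]: "mtrace B (P + Q) = mtrace B P + mtrace B Q"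
  by (simp add: mtrace_def sum.distrib)

lemma mtrace_diff [simp]: "mtrace B (P - Q) = mtrace B P - mtrace B Q"
  by (simp add: mtrace_def sum_subtractf)

lemma mtrace_scale [simp]: "mtrace B (fscale c P) = c * mtrace B P"
  by (simp add: mtrace_def sum_distrib_left)

lemma mtimes_bilinear:
  "mtimes B (P + P') Q = mtimes B P Q + mtimes B P' Q"
  "mtimes B P (Q + Q') = mtimes B P Q + mtimes B P Q'"
  "mtimes B (P - P') Q = mtimes B P Q - mtimes B P' Q"
  "mtimes B P (Q - Q') = mtimes B P Q - mtimes B P Q'"
  "mtimes B (fscale c P) Q = fscale c (mtimes B P Q)"
  "mtimes B P (fscale c Q) = fscale c (mtimes B P Q)"
  by (auto simp: mtimes_def fun_eq_iff distrib_left distrib_right left_diff_distrib right_diff_distrib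
      sum.distrib sum_subtractf sum_distrib_left mult.assoc mult.left_commute)

lemma mapply_bilinear:
  "mapply B (P + P') v = mapply B P v + mapply B P' v"
  "mapply B P (v + v') = mapply B P v + mapply B P v'"
  "mapply B (P - P') v = mapply B P v - mapply B P' v"
  "mapply B P (v - v') = mapply B P v - mapply B P v'"
  "mapply B (fscale c P) v = fscale c (mapply B P v)"
  "mapply B P (fscale c v) = fscale c (mapply B P v)"
  by (auto simp: mapply_def fun_eq_iff distrib_left distrib_right left_diff_distrib right_diff_distrib
      sum.distrib sum_subtractf sum_distrib_left mult.assoc mult.left_commute)

lemma bracket_bilinear:
  "bracket B (P + P') Q = bracket B P Q + bracket B P' Q"
  "bracket B P (Q + Q') = bracket B P Q + bracket B P Q'"
  "bracket B P (fscale c Q) = fscale c (bracket B P Q)"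
  by (simp_all add: bracket_def mtimes_bilinear fs.scale_right_diff_distrib)

lemma bracket_zero [simp]: "bracket B P 0 = 0"
  using bracket_bilinear(3)[of B P 0 0] by simp

lemma mapply_zero [simp]: "mapply B P 0 = 0"
  using mapply_bilinear(6)[of B P 0 0] by simp

lemma mtimes_in_fspace:
  "P \<in> fspace (B \<times> B) \<Longrightarrow> Q \<in> fspace (B \<times> B) \<Longrightarrow> mtimes B P Q \<in> fspace (B \<times> B)"
  by (auto simp: fspace_def mtimes_def intro!: sum.neutral)

lemma mapply_in_fspace: "P \<in> fspace (B \<times> B) \<Longrightarrow> mapply B P v \<in> fspace B"
  by (auto simp: fspace_def mapply_def intro!: sum.neutral)

lemma bracket_in_fspace:
  "P \<in> fspace (B \<times> B) \<Longrightarrow> Q \<in> fspace (B \<times> B) \<Longrightarrow> bracket B P Q \<in> fspace (B \<times> B)"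
  unfolding bracket_def by (intro fs.subspace_diff subspace_fspace mtimes_in_fspace)

text \<open>Invariance of the trace form: by cyclicity of the trace, bracketing with
  \<open>X\<close> is skew-adjoint.\<close>

lemma mtrace_bracket: "mtrace B (mtimes B U (bracket B X P)) = mtrace B (mtimes B (bracket B U X) P)"
  using mtrace_commute[of B "mtimes B U P" X]
  by (simp add: bracket_def mtimes_bilinear mtimes_assoc)

text \<open>Pairing with the matrix unit at \<open>(j, i)\<close> reads off the entry of
  \<open>P\<close> at \<open>(i, j)\<close>.\<close>

lemma mtrace_nondegenerate:
  assumes B: "finite B" "P \<in> fspace (B \<times> B)"
    and 0: "\<And>Q. Q \<in> fspace (B \<times> B) \<Longrightarrow> mtrace B (mtimes B P Q) = 0"
  shows "P = 0"
proof -
  have "P (i, j) = 0" if "i \<in> B" "j \<in> B" for i j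
  proof -
    have "mtrace B (mtimes B P (funit (j, i))) = (\<Sum>a\<in>B. \<Sum>k\<in>B. if k = j then (if a = i then P (a, k) else 0) else 0)"
      by (auto simp: mtrace_def mtimes_def funit_def intro!: sum.cong)
    also have "\<dots> = P (i, j)" using that B(1) by simp
    finally show ?thesis using 0[of "funit (j, i)"] that by (auto simp: fspace_def funit_def)
  qed
  then show ?thesis by (intro fspace_eq_0I[OF B(2)]) auto
qed

text \<open>The columns of \<open>P\<close> are the images of the unit vectors.\<close>

lemma mapply_eqI:
  assumes "finite B" "P \<in> fspace (B \<times> B)" "\<And>v. v \<in> fspace B \<Longrightarrow> mapply B P v = 0"
  shows "P = 0"
proof -
  have "P (i, j) = 0" if "i \<in> B" "j \<in> B" for i j
  proof -
    have "mapply B P (funit j) i = P (i, j)"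
      using that assms(1) by (simp add: mapply_def funit_def if_distrib cong: if_cong)
    then show ?thesis using assms(3)[of "funit j"] that by (auto simp: fspace_def funit_def)
  qed
  then show ?thesis by (intro fspace_eq_0I[OF assms(2)]) auto
qed

section \<open>Cocycles and coboundaries of a triple of matrices\<close>

text \<open>A tuple of matrices is stored as one function whose first index numbers the component,
  so that tuples are again vectors for \<open>fscale\<close>.\<close>

definition slice :: "'a \<Rightarrow> ('a \<times> 'b \<Rightarrow> 'k) \<Rightarrow> 'b \<Rightarrow> 'k" where
  "slice n t = (\<lambda>p. t (n, p))"

lemma slice_apply [simp]: "slice n t p = t (n, p)"
  by (simp add: slice_def)

lemma slice_linear [simp]:
  "slice n (s + t) = slice n s + slice n t" "slice n (fscale c t) = fscale c (slice n t)"
  "slice n 0 = (0 :: 'b \<Rightarrow> 'k::field)"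
  by (simp_all add: slice_def fun_eq_iff)

lemma slice_in_fspace: "t \<in> fspace (N \<times> \<Omega>) \<Longrightarrow> slice n t \<in> fspace \<Omega>"
  by (auto simp: fspace_def)

locale matrix_triple =
  fixes B :: "'i set" and X :: "nat \<Rightarrow> 'i \<times> 'i \<Rightarrow> 'k::field"
  assumes finite_B: "finite B" and X_in: "\<And>n. X n \<in> fspace (B \<times> B)"
begin

definition commutant :: "('i \<times> 'i \<Rightarrow> 'k) set" where
  "commutant = {U \<in> fspace (B \<times> B). bracket B (X 0) U = 0 \<and> bracket B (X 1) U = 0}"

text \<open>The linearised commutation relations: the terms of first order in \<epsilon> in the
  bracket of \<open>X m + \<epsilon> A m\<close> and \<open>X n + \<epsilon> A n\<close>
  cancel.\<close>

definition cocycles :: "(nat \<times> 'i \<times> 'i \<Rightarrow> 'k) set" where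
  "cocycles = {t \<in> fspace ({..<3} \<times> B \<times> B). \<forall>m<3. \<forall>n<3.
     bracket B (X m) (slice n t) = bracket B (X n) (slice m t)}"

text \<open>The directions, up to sign, tangent to the orbit of the triple \<open>X\<close> under
  simultaneous conjugation.\<close>

definition coboundary :: "('i \<times> 'i \<Rightarrow> 'k) \<Rightarrow> nat \<times> 'i \<times> 'i \<Rightarrow> 'k" where
  "coboundary U = (\<lambda>(n, p). if n < 3 then bracket B (X n) U p else 0)"

text \<open>The defect in the cocycle relation between the components 0 and 1. Only these two enter,
  so the map is studied on \<open>pairs\<close>.\<close>

definition kappa :: "(nat \<times> 'i \<times> 'i \<Rightarrow> 'k) \<Rightarrow> 'i \<times> 'i \<Rightarrow> 'k" where
  "kappa t = bracket B (X 0) (slice 1 t) - bracket B (X 1) (slice 0 t)"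

abbreviation pairs :: "(nat \<times> 'i \<times> 'i \<Rightarrow> 'k) set" where
  "pairs \<equiv> fspace ({..<2} \<times> B \<times> B)"

lemma linear_kappa: "Vector_Spaces.linear fscale fscale kappa"
  by (rule fs_linearI) (simp_all add: kappa_def  bracket_bilinear fs.scale_right_diff_distrib)

lemma linear_coboundary: "Vector_Spaces.linear fscale fscale coboundary"
  by (rule fs_linearI; rule ext) (auto simp: coboundary_def bracket_bilinear split: prod.split)

lemma subspace_cocycles: "fs.subspace cocycles"
  unfolding cocycles_def fs.subspace_def using subspace_fspace[of "{..<3} \<times> B \<times> B"]
  by (auto simp:  bracket_bilinear fs.subspace_def)

lemma subspace_commutant: "fs.subspace commutant"
  unfolding commutant_def fs.subspace_def using subspace_fspace[of "B \<times> B"]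
  by (auto simp: bracket_bilinear fs.subspace_def)

lemma commutant_subset: "commutant \<subseteq> fspace (B \<times> B)"
  by (auto simp: commutant_def)

lemma kappa_in:
  assumes "t \<in> pairs"
  shows "kappa t \<in> fspace (B \<times> B)"
proof -
  have "slice n t \<in> fspace (B \<times> B)" for n
    using assms by (rule slice_in_fspace)
  then show ?thesis unfolding kappa_def
    by (intro fs.subspace_diff subspace_fspace bracket_in_fspace X_in)
qed

text \<open>Testing against pairs with one zero component and moving the bracket across the trace
  form shows that the bracket of \<open>U\<close> with \<open>X n\<close> is orthogonal to every
  matrix.\<close>

lemma orthogonal_kappa_imp_commutant:
  assumes U: "U \<in> fspace (B \<times> B)" and 0: "\<And>t. t \<in> pairs \<Longrightarrow> mtrace B (mtimes B U (kappa t)) = 0"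
  shows "U \<in> commutant"
proof -
  have *: "bracket B U (X n) = 0" if n: "n < 2" for n
  proof (rule mtrace_nondegenerate[OF finite_B])
    show "bracket B U (X n) \<in> fspace (B \<times> B)" by (intro bracket_in_fspace U X_in)
    fix Q :: "'i \<times> 'i \<Rightarrow> 'k" assume Q: "Q \<in> fspace (B \<times> B)"
    \<comment> \<open>\<open>kappa\<close> brackets \<open>X n\<close> with component
      \<open>1 - n\<close>, so \<open>Q\<close> is placed there; the value of \<open>n\<close> then
      only affects the sign.\<close>
    define t where "t = (\<lambda>(m, p). if m = 1 - n then Q p else 0)"
    have "t \<in> pairs" using Q n by (auto simp: t_def fspace_def)
    then have z: "mtrace B (mtimes B U (kappa t)) = 0" by (rule 0)
    have s: "slice (1 - n) t = Q" "slice n t = 0"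
      using n by (auto simp: t_def fun_eq_iff) presburger+
    from n consider "n = 0" | "n = 1" by linarith
    then have "kappa t = fscale 1 (bracket B (X n) Q) \<or> kappa t = fscale (- 1) (bracket B (X n) Q)"
      by cases (use s in \<open>auto simp: kappa_def\<close>)
    then have "mtrace B (mtimes B U (bracket B (X n) Q)) = 0"
      using z by (auto simp del: fs.scale_minus_left simp: mtimes_bilinear(6))
    then show "mtrace B (mtimes B (bracket B U (X n)) Q) = 0" by (simp add: mtrace_bracket)
  qed
  have "bracket B (X n) U = 0" if "n < 2" for n
    using *[OF that] by (simp add: bracket_def)
  from this[of 0] this[of 1] show ?thesis using U by (simp add: commutant_def)
qed

text \<open>
  The orthogonal complement of the range of \<open>kappa\<close> under the trace form lies in the commutant,
  so the range has codimension at most that of the commutant.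
\<close>

lemma card_le_dim_range_kappa: "card B * card B \<le> fs.dim (kappa ` pairs) + fs.dim commutant"
proof -
  have sub: "kappa ` pairs \<subseteq> fspace (B \<times> B)" using kappa_in by auto
  obtain W where W: "W \<subseteq> kappa ` pairs" "fs.independent W" "kappa ` pairs \<subseteq> fs.span W"
    "card W = fs.dim (kappa ` pairs)"
    using fs.basis_exists by blast
  have finW: "finite W"
    using fs.independent_span_bound[OF _ W(2), of "funit ` (B \<times> B)"] W(1) sub finite_B
      fspace_span[of "B \<times> B"] by blast
  \<comment> \<open>\<open>\<theta> U\<close> lists the pairings of \<open>U\<close> with a basis of
    the range of \<open>kappa\<close>: its kernel is the orthogonal complement of the range, its
    rank at most \<open>card W\<close>.\<close>
  define \<theta> where "\<theta> U = (\<lambda>w. if w \<in> W then mtrace B (mtimes B U w) else 0)" for U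
  have lin: "Vector_Spaces.linear fscale fscale \<theta>"
    by (rule fs_linearI) (auto simp: \<theta>_def mtimes_bilinear fun_eq_iff)
  have "{U \<in> fspace (B \<times> B). \<theta> U = 0} \<subseteq> commutant"
  proof clarify
    fix U assume U: "U \<in> fspace (B \<times> B)" and 0: "\<theta> U = 0"
    have w: "mtrace B (mtimes B U w) = 0" if "w \<in> W" for w
      using fun_cong[OF 0, of w] that by (simp add: \<theta>_def)
    \<comment> \<open>A scalar is viewed as a function on \<open>unit\<close>, which turns the
      linear form into a map between function spaces.\<close>
    have lin': "Vector_Spaces.linear fscale fscale (\<lambda>w _::unit. mtrace B (mtimes B U w))"
      by (rule fs_linearI) (auto simp: mtimes_bilinear fun_eq_iff)
    have "(\<lambda>_::unit. mtrace B (mtimes B U w)) = 0" if "w \<in> fs.span W" for w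
      by (rule fsp.linear_eq_0_on_span[OF lin' _ that]) (simp add: w fun_eq_iff)
    then have "mtrace B (mtimes B U w) = 0" if "w \<in> fs.span W" for w
      using that by (metis zero_fun_apply)
    then show "U \<in> commutant" using W(3) by (intro orthogonal_kappa_imp_commutant U) blast
  qed
  then have "fs.dim {U \<in> fspace (B \<times> B). \<theta> U = 0} \<le> fs.dim commutant"
    by (rule fs_dim_mono[OF _ commutant_subset]) (simp add: finite_B)
  moreover have "fs.dim (\<theta> ` fspace (B \<times> B)) \<le> card W"
    by (rule fs_dim_le_card[OF _ finW]) (auto simp: \<theta>_def fspace_def)
  moreover have "fs.dim (fspace (B \<times> B) :: ('i \<times> 'i \<Rightarrow> 'k) set) = card B * card B"
    by (simp add: dim_fspace finite_B card_cartesian_product)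
  ultimately show ?thesis
    using fs_dim_image_kernel[OF lin subspace_fspace subset_refl, of "B \<times> B"] finite_B W(4) by simp
qed

text \<open>Rank-nullity on \<open>pairs\<close>, of dimension \<open>2 * (card B)^2\<close>, with
  the lower bound just found for the rank.\<close>

lemma dim_kernel_kappa: "fs.dim {t \<in> pairs. kappa t = 0} \<le> card B * card B + fs.dim commutant"
proof -
  have "fs.dim pairs = 2 * (card B * card B)"
    by (simp add: dim_fspace finite_B card_cartesian_product)
  then show ?thesis
    using fs_dim_image_kernel[OF linear_kappa subspace_fspace subset_refl, of "{..<2} \<times> B \<times> B"] finite_B
      card_le_dim_range_kappa by simp
qed

text \<open>Forgetting the component 2 sends cocycles into the kernel of \<open>kappa\<close>. If
  the other components vanish, the cocycle relations make the component 2 commute with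
  \<open>X 0\<close> and \<open>X 1\<close>.\<close>

lemma dim_cocycles: "fs.dim cocycles \<le> card B * card B + 2 * fs.dim commutant"
proof -
  define pr :: "(nat \<times> 'i \<times> 'i \<Rightarrow> 'k) \<Rightarrow> nat \<times> 'i \<times> 'i \<Rightarrow> 'k"
    where "pr t = (\<lambda>(n, p). if n < 2 then t (n, p) else 0)" for t
  define sl :: "(nat \<times> 'i \<times> 'i \<Rightarrow> 'k) \<Rightarrow> 'i \<times> 'i \<Rightarrow> 'k"
    where "sl t = slice 2 t" for t
  have lin: "Vector_Spaces.linear fscale fscale pr" "Vector_Spaces.linear fscale fscale sl"
    by (rule fs_linearI; auto simp: pr_def sl_def fun_eq_iff)+
  let ?K = "{t \<in> cocycles. pr t = 0}"
  have fin: "finite ({..<n::nat} \<times> B \<times> B)" for n using finite_B by simp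
  have "pr ` cocycles \<subseteq> {t \<in> pairs. kappa t = 0}"
  proof clarify
    fix t assume t: "t \<in> cocycles"
    have s: "slice 0 (pr t) = slice 0 t" "slice (Suc 0) (pr t) = slice (Suc 0) t"
      by (auto simp: pr_def fun_eq_iff)
    have "bracket B (X 0) (slice 1 t) = bracket B (X 1) (slice 0 t)"
      using t by (auto simp: cocycles_def)
    then have "kappa (pr t) = 0" by (simp add: kappa_def s)
    moreover have "pr t \<in> pairs" using t by (auto simp: cocycles_def fspace_def pr_def)
    ultimately show "pr t \<in> pairs \<and> kappa (pr t) = 0" by simp
  qed
  then have 1: "fs.dim (pr ` cocycles) \<le> fs.dim {t \<in> pairs. kappa t = 0}"
    by (rule fs_dim_mono[OF _ _ fin[of 2]]) auto
  have zero: "t (n, p) = 0" if "pr t = 0" "n < 2" for n p t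
    using fun_cong[OF that(1), of "(n, p)"] that(2) by (simp add: pr_def)
  have 2: "fs.dim ?K \<le> fs.dim commutant"
  proof (rule fs_dim_le_inj[OF lin(2) _ _ _ commutant_subset])
    show "fs.subspace ?K"
      using fs.subspace_inter[OF subspace_cocycles fsp.linear_subspace_kernel[OF lin(1)]]
      by (simp add: Collect_conj_eq)
    fix t assume "t \<in> ?K" "sl t = 0"
    then have t: "t \<in> cocycles" "pr t = 0" and s: "\<And>p. t (2, p) = 0"
      by (auto simp: sl_def fun_eq_iff)
    have "t (n, p) = 0" for n p
    proof -
      consider "n < 2" | "n = 2" | "n \<ge> 3" by linarith
      then show ?thesis
      proof cases
        case 3
        then have "(n, p) \<notin> {..<3} \<times> B \<times> B" by auto
        then show ?thesis using t(1) unfolding cocycles_def fspace_def by blast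
      qed (use zero[OF t(2)] s in auto)
    qed
    then show "t = 0" by auto
  next
    show "sl ` ?K \<subseteq> commutant"
    proof clarify
      fix t assume t: "t \<in> cocycles" "pr t = 0"
      have "bracket B (X n) (sl t) = 0" if "n < 2" for n
      proof -
        have "bracket B (X n) (slice 2 t) = bracket B (X 2) (slice n t)"
          using t(1) that by (simp add: cocycles_def)
        moreover have "slice n t = 0" using zero[OF t(2) that] by auto
        ultimately show ?thesis by (simp add: sl_def)
      qed
      from this[of 0] this[of 1] show "sl t \<in> commutant"
        using t(1) by (auto simp: commutant_def sl_def cocycles_def fspace_def)
    qed
  qed (use finite_B in simp)
  have "fs.dim cocycles = fs.dim (pr ` cocycles) + fs.dim ?K"
    by (rule fs_dim_image_kernel[OF lin(1) subspace_cocycles _ fin[of 3]]) (auto simp: cocycles_def)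
  with 1 2 dim_kernel_kappa show ?thesis by simp
qed

text \<open>The kernel of \<open>coboundary\<close> is the joint commutant of the triple, and
  evaluation at \<open>v\<close> embeds it into \<open>fspace B\<close>.\<close>

lemma dim_coboundaries:
  assumes v: "\<And>U. U \<in> fspace (B \<times> B) \<Longrightarrow> (\<And>n. n < 3 \<Longrightarrow> bracket B (X n) U = 0) \<Longrightarrow>
     mapply B U v = 0 \<Longrightarrow> U = 0"
  shows "card B * card B \<le> fs.dim (coboundary ` fspace (B \<times> B)) + card B"
proof -
  let ?K = "{U \<in> fspace (B \<times> B). coboundary U = 0}"
  have lin: "Vector_Spaces.linear fscale fscale (\<lambda>U. mapply B U v)"
    by (rule fs_linearI) (auto simp: mapply_bilinear)
  have "fs.dim ?K \<le> fs.dim (fspace B :: ('i \<Rightarrow> 'k) set)"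
  proof (rule fs_dim_le_inj[OF lin _ _ _ subset_refl finite_B])
    show "fs.subspace ?K"
      using fs.subspace_inter[OF subspace_fspace fsp.linear_subspace_kernel[OF linear_coboundary]]
      by (simp add: Collect_conj_eq)
    fix U assume U: "U \<in> ?K" "mapply B U v = 0"
    have "bracket B (X n) U = 0" if "n < 3" for n
    proof
      fix p
      have "coboundary U (n, p) = 0" using U(1) by simp
      then show "bracket B (X n) U p = 0 p" using that by (simp add: coboundary_def)
    qed
    from v[OF _ this] show "U = 0" using U by simp
  qed (auto intro: mapply_in_fspace)
  moreover have "fs.dim (fspace (B \<times> B) :: ('i \<times> 'i \<Rightarrow> 'k) set) = card B * card B"
    by (simp add: dim_fspace finite_B card_cartesian_product)
  moreover have "fs.dim (fspace (B \<times> B) :: ('i \<times> 'i \<Rightarrow> 'k) set) = fs.dim (coboundary ` fspace (B \<times> B)) + fs.dim ?K"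
    by (rule fs_dim_image_kernel[OF linear_coboundary subspace_fspace subset_refl, of "B \<times> B"])
      (simp add: finite_B)
  ultimately show ?thesis
    using dim_fspace[OF finite_B, where 'k = 'k] by linarith
qed

text \<open>Simultaneous evaluation at \<open>s\<close> vectors embeds the commutant into
  \<open>s\<close> copies of \<open>fspace B\<close>.\<close>

lemma dim_commutant:
  assumes v: "\<And>U. U \<in> commutant \<Longrightarrow> (\<And>n. n < s \<Longrightarrow> mapply B U (v n) = 0) \<Longrightarrow> U = 0"
  shows "fs.dim commutant \<le> s * card B"
proof -
  define ev where "ev U = (\<lambda>(n, i). if n < s then mapply B U (v n) i else 0)" for U
  have lin: "Vector_Spaces.linear fscale fscale ev"
    by (rule fs_linearI) (auto simp: ev_def mapply_bilinear fun_eq_iff)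
  have "fs.dim commutant \<le> fs.dim (fspace ({..<s} \<times> B) :: (nat \<times> 'i \<Rightarrow> 'k) set)"
  proof (rule fs_dim_le_inj[OF lin subspace_commutant _ _ subset_refl])
    fix U assume U: "U \<in> commutant" "ev U = 0"
    have "mapply B U (v n) = 0" if "n < s" for n
    proof
      fix i
      have "ev U (n, i) = 0" using U(2) by simp
      then show "mapply B U (v n) i = 0 i" using that by (simp add: ev_def)
    qed
    from v[OF _ this] show "U = 0" using U by simp
  next
    show "ev ` commutant \<subseteq> fspace ({..<s} \<times> B)"
    proof clarify
      fix U assume "U \<in> commutant"
      then have "mapply B U (v n) \<in> fspace B" for n using commutant_subset mapply_in_fspace by blast
      then show "ev U \<in> fspace ({..<s} \<times> B)" by (auto simp: ev_def fspace_def)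
    qed
  qed (use finite_B in simp)
  then show ?thesis by (simp add: dim_fspace finite_B card_cartesian_product)
qed

end

section \<open>Ideals of finite colength in coordinates\<close>

lemma const3_simps [simp]:
  "const3 0 = 0" "const3 1 = 1"
  by (simp_all add: const3_def)

lemma const3_add: "const3 (a + b) = const3 a + const3 b"
  by (simp add: const3_def single_add)

lemma const3_mult: "const3 (a * b) = const3 a * const3 b"
  by (simp add: const3_def mult_single)

text \<open>
  \<open>coords f\<close> is the coordinate vector of the class of \<open>f\<close> with respect to the basis of the quotient
  by \<open>I\<close> formed by the classes of the \<open>e i\<close>.
\<close>

locale finite_colength =
  fixes I :: "'k::field poly3 set" and B :: "'i set"
    and coords :: "'k poly3 \<Rightarrow> 'i \<Rightarrow> 'k" and e :: "'i \<Rightarrow> 'k poly3"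
  assumes finite_B: "finite B"
    and coords_in: "\<And>f. coords f \<in> fspace B"
    and coords_add: "\<And>f g. coords (f + g) = coords f + coords g"
    and coords_scale: "\<And>c f. coords (const3 c * f) = fscale c (coords f)"
    and coords_eq_0_iff: "\<And>f. coords f = 0 \<longleftrightarrow> f \<in> I"
    and coords_e: "\<And>i. i \<in> B \<Longrightarrow> coords (e i) = funit i"
    and I_mult: "\<And>f g. f \<in> I \<Longrightarrow> g * f \<in> I"
begin

lemma coords_0 [simp]: "coords 0 = 0"
  using coords_scale[of 0 0] by simp

lemma coords_minus: "coords (- f) = - coords f"
  using coords_add[of f "- f"] by (simp add: add_eq_0_iff)

lemma coords_diff: "coords (f - g) = coords f - coords g"
  using coords_add[of f "- g"] by (simp add: coords_minus)

lemma coords_sum: "coords (\<Sum>x\<in>A. f x) = (\<Sum>x\<in>A. coords (f x))"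
  by (induction A rule: infinite_finite_induct) (auto simp: coords_add)

lemma I_0: "0 \<in> I"
  using coords_eq_0_iff[of 0] by simp

text \<open>A linear section of \<open>coords\<close>.\<close>

definition lift_coords :: "('i \<Rightarrow> 'k) \<Rightarrow> 'k poly3" where
  "lift_coords u = (\<Sum>i\<in>B. const3 (u i) * e i)"

lemma coords_lift: "u \<in> fspace B \<Longrightarrow> coords (lift_coords u) = u"
  unfolding lift_coords_def coords_sum coords_scale
  by (subst (2) fspace_expand[OF finite_B]) (simp_all add: coords_e)

lemma lift_add: "lift_coords (u + v) = lift_coords u + lift_coords v"
  by (simp add: lift_coords_def const3_add distrib_right sum.distrib)

lemma lift_scale: "lift_coords (fscale c u) = const3 c * lift_coords u"
  by (simp add: lift_coords_def const3_mult sum_distrib_left mult.assoc)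

lemma lift_0 [simp]: "lift_coords 0 = 0"
  by (simp add: lift_coords_def)

text \<open>The projection onto \<open>I\<close> along the span of the \<open>e i\<close>.\<close>

definition remainder :: "'k poly3 \<Rightarrow> 'k poly3" where
  "remainder f = f - lift_coords (coords f)"

lemma remainder_in: "remainder f \<in> I"
  unfolding remainder_def by (simp flip: coords_eq_0_iff add: coords_diff coords_lift coords_in)

lemma remainder_add: "remainder (f + g) = remainder f + remainder g"
  by (simp add: remainder_def coords_add lift_add)

lemma remainder_scale: "remainder (const3 c * f) = const3 c * remainder f"
  by (simp add: remainder_def coords_scale lift_scale right_diff_distrib)

lemma remainder_id: "f \<in> I \<Longrightarrow> remainder f = f"
  by (simp add: remainder_def flip: coords_eq_0_iff)

definition mult_matrix :: "'k poly3 \<Rightarrow> 'i \<times> 'i \<Rightarrow> 'k" where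
  "mult_matrix f = (\<lambda>(i, j). if j \<in> B then coords (f * e j) i else 0)"

lemma mult_matrix_in: "mult_matrix f \<in> fspace (B \<times> B)"
  using coords_in by (auto simp: fspace_def mult_matrix_def)

text \<open>Multiplication by \<open>f\<close> passes to the quotient: replacing \<open>g\<close> by
  the lift of its coordinates changes \<open>f * g\<close> by an element of
  \<open>I\<close>.\<close>

lemma mapply_mult_matrix: "mapply B (mult_matrix f) (coords g) = coords (f * g)"
proof -
  have "mapply B (mult_matrix f) u = coords (f * lift_coords u)" for u
  proof
    fix i
    show "mapply B (mult_matrix f) u i = coords (f * lift_coords u) i"
    proof -
      have "f * lift_coords u = (\<Sum>j\<in>B. const3 (u j) * (f * e j))"
        by (simp add: lift_coords_def sum_distrib_left mult.left_commute)
      then show ?thesis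
        by (simp add: mapply_def mult_matrix_def coords_sum sum_fun_apply coords_scale mult.commute cong: sum.cong)
    qed
  qed
  then have "mapply B (mult_matrix f) (coords g) = coords (f * lift_coords (coords g))" .
  also have "\<dots> = coords (f * g) - coords (f * remainder g)"
    by (simp add: remainder_def right_diff_distrib coords_diff)
  also have "coords (f * remainder g) = 0"
    by (simp add: coords_eq_0_iff I_mult remainder_in)
  finally show ?thesis by simp
qed

lemma matrix_eqI:
  assumes "P \<in> fspace (B \<times> B)" "Q \<in> fspace (B \<times> B)"
    and "\<And>f. mapply B P (coords f) = mapply B Q (coords f)"
  shows "P = Q"
proof -
  have "P - Q = 0"
  proof (rule mapply_eqI[OF finite_B])
    show "P - Q \<in> fspace (B \<times> B)" by (intro fs.subspace_diff subspace_fspace assms)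
    fix v :: "'i \<Rightarrow> 'k" assume "v \<in> fspace B"
    then have "v = coords (lift_coords v)" by (simp add: coords_lift)
    then show "mapply B (P - Q) v = 0" using assms(3) by (metis mapply_bilinear(3) right_minus_eq)
  qed
  then show ?thesis by simp
qed

text \<open>
  Only the values of \<open>h\<close> on \<open>I\<close> matter: they are the coordinate vectors of the values of a
  homomorphism from \<open>I\<close> to the quotient.
\<close>

definition tangent :: "('k poly3 \<Rightarrow> 'i \<Rightarrow> 'k) \<Rightarrow> bool" where
  "tangent h \<longleftrightarrow> (\<forall>f\<in>I. h f \<in> fspace B) \<and> (\<forall>f\<in>I. \<forall>g\<in>I. h (f + g) = h f + h g) \<and>
     (\<forall>c. \<forall>f\<in>I. h (const3 c * f) = fscale c (h f)) \<and>
     (\<forall>f\<in>I. \<forall>g. h (g * f) = mapply B (mult_matrix g) (h f))"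

lemma tangentD:
  assumes "tangent h"
  shows "f \<in> I \<Longrightarrow> h f \<in> fspace B" "f \<in> I \<Longrightarrow> g \<in> I \<Longrightarrow> h (f + g) = h f + h g"
    "f \<in> I \<Longrightarrow> h (const3 c * f) = fscale c (h f)"
    "f \<in> I \<Longrightarrow> h (g * f) = mapply B (mult_matrix g) (h f)"
  using assms by (auto simp: tangent_def)

lemma tangent_add: "tangent h \<Longrightarrow> tangent h' \<Longrightarrow> tangent (h + h')"
  by (auto simp: tangent_def fs.subspace_add[OF subspace_fspace] mapply_bilinear fs.scale_right_distrib)

lemma tangent_scale: "tangent h \<Longrightarrow> tangent (\<lambda>f. fscale c (h f))"
  by (auto simp: tangent_def fs.subspace_scale[OF subspace_fspace] mapply_bilinear fs.scale_right_distrib mult.commute)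

end

text \<open>
  The assumptions are induction principles: the \<open>g n\<close> generate the algebra, and the quotient by \<open>I\<close>
  is generated by \<open>1, \<dots>, g 2 ^ (s - 1)\<close> as a module over the subalgebra generated by \<open>g 0\<close> and \<open>g 1\<close>.
\<close>

locale finite_colength_generators = finite_colength I B coords e
  for I :: "'k::field poly3 set" and B :: "'i set" and coords e +
  fixes g :: "nat \<Rightarrow> 'k poly3" and s :: nat
  assumes generate: "\<And>P f. (\<And>f h. P f \<Longrightarrow> P h \<Longrightarrow> P (f + h)) \<Longrightarrow> (\<And>c f. P f \<Longrightarrow> P (const3 c * f)) \<Longrightarrow>
      P 1 \<Longrightarrow> (\<And>n f. n < 3 \<Longrightarrow> P f \<Longrightarrow> P (g n * f)) \<Longrightarrow> P f"
    and generate_quotient: "\<And>P f. (\<And>f h. P f \<Longrightarrow> P h \<Longrightarrow> P (f + h)) \<Longrightarrow> (\<And>c f. P f \<Longrightarrow> P (const3 c * f)) \<Longrightarrow>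
      (\<And>f. f \<in> I \<Longrightarrow> P f) \<Longrightarrow> (\<And>n. n < s \<Longrightarrow> P (g 2 ^ n)) \<Longrightarrow>
      (\<And>n f. n < 2 \<Longrightarrow> P f \<Longrightarrow> P (g n * f)) \<Longrightarrow> P f"
begin

sublocale matrix_triple B "\<lambda>n. mult_matrix (g n)"
  by unfold_locales (auto simp: finite_B mult_matrix_in)

text \<open>
  Extend \<open>h\<close> from \<open>I\<close> to all polynomials by letting it vanish on the span of the \<open>e i\<close>. The
  components of \<open>cocycle_of h\<close> measure how far this extension is from commuting with the \<open>g n\<close>.
\<close>

definition cocycle_of :: "('k poly3 \<Rightarrow> 'i \<Rightarrow> 'k) \<Rightarrow> nat \<times> 'i \<times> 'i \<Rightarrow> 'k" where
  "cocycle_of h = (\<lambda>(n, i, j). if n < 3 \<and> j \<in> B then h (remainder (g n * e j)) i else 0)"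

lemma cocycle_of_add: "cocycle_of (h + h') = cocycle_of h + cocycle_of h'"
  by (auto simp: cocycle_of_def fun_eq_iff)

lemma cocycle_of_scale: "cocycle_of (\<lambda>f. fscale c (h f)) = fscale c (cocycle_of h)"
  by (auto simp: cocycle_of_def fun_eq_iff)

lemma cocycle_of_in: "tangent h \<Longrightarrow> cocycle_of h \<in> fspace ({..<3} \<times> B \<times> B)"
  using tangentD(1)[OF _ remainder_in] by (fastforce simp: cocycle_of_def fspace_def)

lemma tangent_remainder_sum:
  assumes "tangent h" "finite A"
  shows "h (remainder (\<Sum>i\<in>A. const3 (u i) * f i)) = (\<Sum>i\<in>A. fscale (u i) (h (remainder (f i))))"
  using assms(2)
proof induction
  case empty
  have "h (const3 0 * 0) = fscale 0 (h 0)" by (rule tangentD(3)[OF assms(1) I_0])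
  then show ?case by (simp add: remainder_def)
next
  case (insert a A)
  then show ?case
    by (simp add: remainder_add remainder_scale tangentD(2,3)[OF assms(1)] remainder_in I_mult)
qed

text \<open>The component is the commutator of the extension
  \<open>f \<mapsto> h (remainder f)\<close> with \<open>g n\<close>. It descends to the quotient
  because both terms on the right agree for \<open>f\<close> in \<open>I\<close>.\<close>

lemma mapply_cocycle_of:
  assumes h: "tangent h" and n: "n < 3"
  shows "mapply B (slice n (cocycle_of h)) (coords f) =
    h (remainder (g n * f)) - mapply B (mult_matrix (g n)) (h (remainder f))"
proof -
  have "mapply B (slice n (cocycle_of h)) u = h (remainder (g n * lift_coords u))" for u
  proof -
    have "g n * lift_coords u = (\<Sum>i\<in>B. const3 (u i) * (g n * e i))"
      by (simp add: lift_coords_def sum_distrib_left mult.left_commute)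
    then have "h (remainder (g n * lift_coords u)) = (\<Sum>i\<in>B. fscale (u i) (h (remainder (g n * e i))))"
      by (simp add: tangent_remainder_sum[OF h finite_B])
    then show ?thesis
      using n by (simp add: fun_eq_iff mapply_def cocycle_of_def sum_fun_apply mult.commute cong: sum.cong)
  qed
  moreover have "g n * f = g n * lift_coords (coords f) + g n * remainder f"
    by (simp add: remainder_def right_diff_distrib)
  then have "h (remainder (g n * f)) = h (remainder (g n * lift_coords (coords f))) + h (remainder (g n * remainder f))"
    by (simp add: remainder_add tangentD(2)[OF h] remainder_in)
  moreover have "h (remainder (g n * remainder f)) = mapply B (mult_matrix (g n)) (h (remainder f))"
    by (simp add: remainder_id I_mult remainder_in tangentD(4)[OF h])
  ultimately show ?thesis by simp
qed

lemma mapply_mult_matrix_commute: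
  assumes "v \<in> fspace B"
  shows "mapply B (mult_matrix f) (mapply B (mult_matrix f') v) = mapply B (mult_matrix f') (mapply B (mult_matrix f) v)"
proof -
  have "v = coords (lift_coords v)" using assms by (simp add: coords_lift)
  then show ?thesis by (metis mapply_mult_matrix mult.left_commute)
qed

text \<open>The components are commutators of one and the same linear map with multiplications that
  commute among themselves.\<close>

lemma cocycle_of_cocycle:
  assumes h: "tangent h"
  shows "cocycle_of h \<in> cocycles"
proof -
  let ?A = "\<lambda>n. slice n (cocycle_of h)" and ?X = "\<lambda>n. mult_matrix (g n)"
  have A: "?A n \<in> fspace (B \<times> B)" for n
    using cocycle_of_in[OF h] by (rule slice_in_fspace)
  have "bracket B (?X m) (?A n) = bracket B (?X n) (?A m)" if mn: "m < 3" "n < 3" for m n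
  proof (rule matrix_eqI)
    fix f
    \<comment> \<open>This expansion is symmetric in \<open>m\<close> and \<open>n\<close>, up to
      the order of the multiplications.\<close>
    have *: "mapply B (bracket B (?X m) (?A n)) (coords f) =
        mapply B (?X m) (h (remainder (g n * f))) + mapply B (?X n) (h (remainder (g m * f)))
        - mapply B (?X m) (mapply B (?X n) (h (remainder f))) - h (remainder (g n * (g m * f)))"
      if "m < 3" "n < 3" for m n
      by (simp add: bracket_def mapply_bilinear mapply_mtimes mapply_cocycle_of[OF h] that mapply_mult_matrix)
    show "mapply B (bracket B (?X m) (?A n)) (coords f) = mapply B (bracket B (?X n) (?A m)) (coords f)"
      using mapply_mult_matrix_commute[OF tangentD(1)[OF h remainder_in]]
      by (simp add: * mn mult.left_commute add.commute)
  qed (intro bracket_in_fspace mult_matrix_in A)+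
  then show ?thesis using cocycle_of_in[OF h] by (simp add: cocycles_def)
qed

text \<open>Correcting the extension of \<open>h\<close> by \<open>U\<close> gives a map
  \<open>\<psi>\<close> on all polynomials that commutes with the \<open>g n\<close>. Hence
  \<open>\<psi> f\<close> is \<open>f\<close> times the class \<open>\<psi> 1\<close>, which is 0
  for \<open>f\<close> in \<open>I\<close>; and on \<open>I\<close> the maps \<open>\<psi>\<close>
  and \<open>h\<close> agree.\<close>

lemma cocycle_of_coboundary:
  assumes h: "tangent h" and U: "U \<in> fspace (B \<times> B)" and eq: "cocycle_of h = coboundary U"
    and f: "f \<in> I"
  shows "h f = 0"
proof -
  define \<psi> where "\<psi> f = h (remainder f) + mapply B U (coords f)" for f
  have \<psi>_in: "\<psi> f \<in> fspace B" for f
    unfolding \<psi>_def using U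
    by (intro fs.subspace_add subspace_fspace mapply_in_fspace tangentD(1)[OF h] remainder_in)
  have \<psi>_add: "\<psi> (f + f') = \<psi> f + \<psi> f'" for f f'
    by (simp add: \<psi>_def remainder_add tangentD[OF h] remainder_in coords_add mapply_bilinear)
  have \<psi>_scale: "\<psi> (const3 c * f) = fscale c (\<psi> f)" for c f
    by (simp add: \<psi>_def remainder_scale tangentD(3)[OF h] remainder_in coords_scale mapply_bilinear
      fs.scale_right_distrib)
  have \<psi>_g: "\<psi> (g n * f) = mapply B (mult_matrix (g n)) (\<psi> f)" if n: "n < 3" for n f
  proof -
    have "slice n (cocycle_of h) = bracket B (mult_matrix (g n)) U"
      using n by (simp add: eq fun_eq_iff coboundary_def)
    then have "mapply B (bracket B (mult_matrix (g n)) U) (coords f) =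
      h (remainder (g n * f)) - mapply B (mult_matrix (g n)) (h (remainder f))"
      using mapply_cocycle_of[OF h n, of f] by simp
    then show ?thesis
      by (simp add: \<psi>_def bracket_def mapply_bilinear mapply_mtimes mapply_mult_matrix algebra_simps)
  qed
  have "\<psi> f = coords (f * lift_coords (\<psi> 1))" for f
  proof (rule generate[of "\<lambda>f. \<psi> f = coords (f * lift_coords (\<psi> 1))"])
    show "\<psi> 1 = coords (1 * lift_coords (\<psi> 1))" by (simp add: coords_lift \<psi>_in)
  qed (simp_all add: \<psi>_add \<psi>_scale \<psi>_g distrib_right coords_add coords_scale mult.assoc mapply_mult_matrix)
  then have "\<psi> f = coords (lift_coords (\<psi> 1) * f)" by (metis mult.commute)
  also have "\<dots> = 0" using coords_eq_0_iff I_mult[OF f] by blast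
  moreover have "coords f = 0" using f coords_eq_0_iff by blast
  ultimately show ?thesis
    by (simp add: \<psi>_def remainder_id[OF f])
qed

lemma mapply_bracket_eq_0:
  assumes "bracket B (mult_matrix f) U = 0"
  shows "mapply B U (coords (f * f')) = mapply B (mult_matrix f) (mapply B U (coords f'))"
proof -
  have "mapply B (bracket B (mult_matrix f) U) (coords f') = 0"
    using mapply_bilinear(5)[of B 0 0 "coords f'"] assms by simp
  then show ?thesis by (simp add: bracket_def mapply_bilinear mapply_mtimes mapply_mult_matrix)
qed

text \<open>Let \<open>d = card B\<close> and let \<open>c\<close> be the dimension of the
  commutant. The tangent part and the coboundaries, of dimension at least \<open>d^2 - d\<close>,
  meet only in 0 inside the cocycles, of dimension at most \<open>d^2 + 2 c\<close>; finally
  \<open>c \<le> s d\<close>.\<close>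

lemma dim_cocycle_of:
  shows "fs.subspace (cocycle_of ` Collect tangent)"
    and "fs.dim (cocycle_of ` Collect tangent) \<le> (2 * s + 1) * card B"
proof -
  let ?T = "cocycle_of ` Collect tangent"
  show sub: "fs.subspace ?T"
  proof (rule fs.subspaceI)
    have "tangent 0"
      by (simp add: tangent_def fs.subspace_0[OF subspace_fspace])
    moreover have "cocycle_of 0 = 0" by (simp add: cocycle_of_def fun_eq_iff)
    ultimately show "0 \<in> ?T" by (metis image_eqI mem_Collect_eq)
  next
    fix x y assume "x \<in> ?T" "y \<in> ?T"
    then show "x + y \<in> ?T" by (auto simp flip: cocycle_of_add intro!: imageI tangent_add)
  next
    fix c x assume "x \<in> ?T"
    then show "fscale c x \<in> ?T" by (auto simp flip: cocycle_of_scale intro!: imageI tangent_scale)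
  qed
  have fin: "finite ({..<3::nat} \<times> B \<times> B)" using finite_B by simp
  have "fs.dim ?T + fs.dim (coboundary ` fspace (B \<times> B)) \<le> fs.dim cocycles"
  proof (rule fs.dim_sum_disjoint[OF sub fsp.linear_subspace_image[OF linear_coboundary subspace_fspace]])
    show "?T \<inter> coboundary ` fspace (B \<times> B) \<subseteq> {0}"
    proof clarify
      fix h U assume h: "tangent h" and U: "U \<in> fspace (B \<times> B)" and eq: "cocycle_of h = coboundary U"
      have "h f = 0" if "f \<in> I" for f using cocycle_of_coboundary[OF h U eq that] .
      then show "cocycle_of h = 0" by (auto simp: cocycle_of_def fun_eq_iff remainder_in)
    qed
    show "?T \<subseteq> cocycles" using cocycle_of_cocycle by blast
    show "coboundary ` fspace (B \<times> B) \<subseteq> cocycles"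
    proof clarify
      fix U :: "'i \<times> 'i \<Rightarrow> 'k" assume U: "U \<in> fspace (B \<times> B)"
      let ?X = "\<lambda>n. mult_matrix (g n)"
      have sl: "slice n (coboundary U) = bracket B (?X n) U" if "n < 3" for n
        using that by (simp add: fun_eq_iff coboundary_def)
      have "bracket B (?X n) U \<in> fspace (B \<times> B)" for n by (intro bracket_in_fspace mult_matrix_in U)
      then have "coboundary U \<in> fspace ({..<3} \<times> B \<times> B)"
        by (auto simp: fspace_def coboundary_def)
      \<comment> \<open>The Jacobi identity for commuting multiplication matrices makes coboundaries
        cocycles.\<close>
      moreover have "bracket B (?X m) (bracket B (?X n) U) = bracket B (?X n) (bracket B (?X m) U)" for m n
      proof (rule matrix_eqI)
        fix f
        show "mapply B (bracket B (?X m) (bracket B (?X n) U)) (coords f) =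
          mapply B (bracket B (?X n) (bracket B (?X m) U)) (coords f)"
          using mapply_mult_matrix_commute[OF mapply_in_fspace[OF U]]
          by (simp add: bracket_def mapply_bilinear mapply_mtimes mapply_mult_matrix mult.left_commute)
      qed (intro bracket_in_fspace mult_matrix_in U)+
      ultimately show "coboundary U \<in> cocycles" by (simp add: cocycles_def sl)
    qed
    show "cocycles \<subseteq> fs.span (funit ` ({..<3::nat} \<times> B \<times> B))"
      using fspace_span[OF fin] by (auto simp: cocycles_def)
  qed (use fin in simp)
  \<comment> \<open>The class of 1 generates the quotient under all the \<open>g n\<close>, so it
    can serve as the test vector.\<close>
  moreover have "card B * card B \<le> fs.dim (coboundary ` fspace (B \<times> B)) + card B"
  proof (rule dim_coboundaries[of "coords 1"])
    fix U assume U: "U \<in> fspace (B \<times> B)" "\<And>n. n < 3 \<Longrightarrow> bracket B (mult_matrix (g n)) U = 0"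
      "mapply B U (coords 1) = 0"
    have "mapply B U (coords f) = 0" for f
      by (rule generate[of "\<lambda>f. mapply B U (coords f) = 0"])
        (simp_all add: U coords_add coords_scale mapply_bilinear mapply_bracket_eq_0)
    moreover have "mapply B 0 v = 0" for v using mapply_bilinear(5)[of B 0 0 v] by simp
    ultimately show "U = 0" by (intro matrix_eqI U fs.subspace_0 subspace_fspace) simp
  qed
  \<comment> \<open>Under \<open>g 0\<close> and \<open>g 1\<close> alone, generators are the
    classes of the powers of \<open>g 2\<close> with exponent below \<open>s\<close>.\<close>
  moreover have "fs.dim commutant \<le> s * card B"
  proof (rule dim_commutant[of s "\<lambda>n. coords (g 2 ^ n)"])
    fix U assume U: "U \<in> commutant" "\<And>n. n < s \<Longrightarrow> mapply B U (coords (g 2 ^ n)) = 0"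
    have br: "bracket B (mult_matrix (g n)) U = 0" if "n < 2" for n
      using U(1) that by (cases n) (auto simp: commutant_def)
    have "mapply B U (coords f) = 0" for f
    proof (rule generate_quotient[of "\<lambda>f. mapply B U (coords f) = 0"])
      fix f assume "f \<in> I"
      then have "coords f = 0" using coords_eq_0_iff by blast
      then show "mapply B U (coords f) = 0" by simp
    qed (simp_all add: U coords_add coords_scale mapply_bilinear mapply_bracket_eq_0 br)
    moreover have "mapply B 0 v = 0" for v using mapply_bilinear(5)[of B 0 0 v] by simp
    moreover have "U \<in> fspace (B \<times> B)" using U(1) commutant_subset by blast
    ultimately show "U = 0" by (intro matrix_eqI fs.subspace_0 subspace_fspace) simp_all
  qed
  ultimately show "fs.dim ?T \<le> (2 * s + 1) * card B"
    using dim_cocycles by (simp add: algebra_simps)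
qed

text \<open>The case \<open>U = 0\<close> of \<open>cocycle_of_coboundary\<close>.\<close>

lemma cocycle_of_inj:
  assumes "tangent h" "cocycle_of h = 0" "f \<in> I"
  shows "h f = 0"
proof (rule cocycle_of_coboundary[OF assms(1) _ _ assms(3)])
  show "cocycle_of h = coboundary 0" unfolding assms(2)
    by (auto simp: coboundary_def fun_eq_iff)
qed (simp add: fs.subspace_0[OF subspace_fspace])

end

section \<open>Linear coordinates in general position\<close>

lemma exhaust_three: "(i :: 3) = 0 \<or> i = 1 \<or> i = 2"
proof (induct i)
  case (of_int z)
  then have "z = 0 \<or> z = 1 \<or> z = 2" by auto
  then show ?case by auto
qed

lemma update_eq_single_plus:
  assumes "k \<notin> Poly_Mapping.keys q"
  shows "Poly_Mapping.update k v q = Poly_Mapping.single k v + q"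
  using assms by (intro poly_mapping_eqI) (auto simp: lookup_update lookup_add lookup_single in_keys_iff)

text \<open>Polynomials are built one monomial at a time, and exponent vectors one variable at a
  time.\<close>

lemma poly3_induct [case_names add scale one var]:
  fixes f :: "'k::field poly3"
  assumes add: "\<And>f h. P f \<Longrightarrow> P h \<Longrightarrow> P (f + h)" and scale: "\<And>c f. P f \<Longrightarrow> P (const3 c * f)"
    and one: "P 1" and var: "\<And>i f. P f \<Longrightarrow> P (var3 i * f)"
  shows "P f"
proof -
  have single: "P (Poly_Mapping.single k v)" for k v
  proof (induction k rule: update_induct)
    case const
    show ?case using scale[OF one, of v] by (simp add: const3_def)
  next
    case (update k i n)
    have "P (Poly_Mapping.single (Poly_Mapping.single i n + k) v)" for n
    proof (induction n)
      case (Suc n)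
      have "Poly_Mapping.single (Poly_Mapping.single i (Suc n) + k) v =
        var3 i * Poly_Mapping.single (Poly_Mapping.single i n + k) v"
        by (simp add: var3_def mult_single add.assoc[symmetric] flip: single_add)
      then show ?case using var[OF Suc] by simp
    qed (use update in simp)
    then show ?case by (simp add: update_eq_single_plus[OF update(1)])
  qed
  show ?thesis
  proof (induction f rule: update_induct)
    case const
    show ?case using scale[OF one, of 0] by simp
  next
    case (update f k v)
    then show ?case by (simp add: add[OF single] update_eq_single_plus)
  qed
qed

section \<open>Counting monomials by degree\<close>

definition simplex3 :: "nat \<Rightarrow> (nat \<times> nat \<times> nat) set" where
  "simplex3 r = {(a, b, c). a + b + c \<le> r}"

lemma finite_card_triangle:
  "finite {(a, b). a + b \<le> (r::nat)}" "card {(a, b). a + b \<le> r} = (r + 2) choose 2"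
proof -
  have eq: "{(a, b). a + b \<le> r} = (SIGMA a:{..r}. {..r - a})" by auto
  show "finite {(a, b). a + b \<le> r}" unfolding eq by simp
  have "card {(a, b). a + b \<le> r} = (\<Sum>a\<le>r. Suc (r - a))"
    unfolding eq by simp
  also have "\<dots> = (\<Sum>a\<le>r. Suc a)"
    by (rule sum.reindex_bij_witness[of _ "\<lambda>a. r - a" "\<lambda>a. r - a"]) auto
  also have "\<dots> = (r + 2) choose 2"
    by (induction r) (simp_all add: numeral_2_eq_2)
  finally show "card {(a, b). a + b \<le> r} = (r + 2) choose 2" .
qed

lemma finite_card_slice:
  "finite {(a, b, c). a + b + c = (r::nat)}" "card {(a, b, c). a + b + c = r} = (r + 2) choose 2"
proof -
  have "bij_betw (\<lambda>(a, b). (a, b, r - a - b)) {(a, b). a + b \<le> r} {(a, b, c). a + b + c = r}"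
    by (rule bij_betw_byWitness[where f' = "\<lambda>(a, b, c). (a, b)"]) auto
  from bij_betw_finite[OF this] bij_betw_same_card[OF this]
  show "finite {(a, b, c). a + b + c = r}" "card {(a, b, c). a + b + c = r} = (r + 2) choose 2"
    using finite_card_triangle[of r] by simp_all
qed

lemma finite_simplex3: "finite (simplex3 r)"
  by (rule finite_subset[of _ "{..r} \<times> {..r} \<times> {..r}"]) (auto simp: simplex3_def)

lemma card_simplex3: "card (simplex3 r) = (r + 3) choose 3"
proof (induction r)
  case 0
  have "simplex3 0 = {(0, 0, 0)}" by (auto simp: simplex3_def)
  then show ?case by simp
next
  case (Suc r)
  have "simplex3 (Suc r) = simplex3 r \<union> {(a, b, c). a + b + c = Suc r}"
    by (auto simp: simplex3_def)
  moreover have "simplex3 r \<inter> {(a, b, c). a + b + c = Suc r} = {}"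
    by (auto simp: simplex3_def)
  ultimately have "card (simplex3 (Suc r)) = ((r + 3) choose 3) + ((Suc r + 2) choose 2)"
    using card_Un_disjoint[OF finite_simplex3 finite_card_slice(1)] Suc finite_card_slice(2) by metis
  then show ?case by (simp add: numeral_3_eq_3 numeral_2_eq_2)
qed

section \<open>Nonvanishing of polynomials over an infinite field\<close>

lemma poly_nonvanishing:
  fixes u :: "nat \<Rightarrow> 'k::field"
  assumes "infinite (UNIV :: 'k set)" "\<And>p. (\<Sum>a\<le>n. u a * p ^ a) = 0" "a \<le> n"
  shows "u a = 0"
proof -
  let ?q = "\<Sum>a\<le>n. monom (u a) a"
  have "poly ?q p = 0" for p using assms(2)[of p] by (simp add: poly_sum poly_monom)
  then have "?q = 0" using poly_roots_finite[of ?q] assms(1) by auto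
  then have "coeff ?q a = 0" by simp
  then show ?thesis using assms(3) by (simp add: coeff_sum)
qed

text \<open>The case of one variable is applied in \<open>p\<close> for each fixed \<open>q\<close>,
  then in \<open>q\<close> to the resulting coefficient.\<close>

lemma poly2_nonvanishing:
  fixes u :: "nat \<Rightarrow> nat \<Rightarrow> 'k::field"
  assumes inf: "infinite (UNIV :: 'k set)" and u: "u a b \<noteq> 0" "a \<le> n" "b \<le> n"
  shows "\<exists>p q. (\<Sum>a\<le>n. \<Sum>b\<le>n. u a b * p ^ a * q ^ b) \<noteq> 0"
proof (rule ccontr)
  assume "\<not> ?thesis"
  then have 0: "(\<Sum>a\<le>n. (\<Sum>b\<le>n. u a b * q ^ b) * p ^ a) = 0" for p q
    by (simp add: sum_distrib_left sum_distrib_right mult_ac)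
  have "(\<Sum>b\<le>n. u a b * q ^ b) = 0" for q
    by (rule poly_nonvanishing[OF inf 0 u(2)])
  then have "u a b = 0" by (rule poly_nonvanishing[OF inf _ u(3)])
  with u(1) show False by simp
qed

section \<open>Leading coefficients in sheared coordinates\<close>

definition mon3 :: "nat \<times> nat \<times> nat \<Rightarrow> 'k::field poly3" where
  "mon3 = (\<lambda>(a, b, c). var3 0 ^ a * var3 1 ^ b * var3 2 ^ c)"

text \<open>Modulo the first two of these coordinates, \<open>x\<close> becomes \<open>p z\<close>
  and \<open>y\<close> becomes \<open>q z\<close>. The leading coefficient in \<open>z\<close> of a
  form is then its value at \<open>(p, q, 1)\<close>.\<close>

definition affine_coords :: "'k::field \<Rightarrow> 'k \<Rightarrow> nat \<Rightarrow> 'k poly3" where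
  "affine_coords p q n = (if n = 0 then var3 0 - const3 p * var3 2
     else if n = 1 then var3 1 - const3 q * var3 2 else var3 2)"

lemma affine_coords_simps [simp]:
  "affine_coords p q 0 = var3 0 - const3 p * var3 2"
  "affine_coords p q (Suc 0) = var3 1 - const3 q * var3 2"
  "affine_coords p q 2 = var3 2"
  by (simp_all add: affine_coords_def)

text \<open>
  Polynomials of degree less than \<open>n\<close> in \<open>var3 2\<close> when written in the coordinates \<open>affine_coords p q\<close>.
\<close>

inductive_set zdegree_less :: "'k::field \<Rightarrow> 'k \<Rightarrow> nat \<Rightarrow> 'k poly3 set" for p q n where
  zero: "0 \<in> zdegree_less p q n"
| pow: "i < n \<Longrightarrow> var3 2 ^ i \<in> zdegree_less p q n"
| add: "f \<in> zdegree_less p q n \<Longrightarrow> h \<in> zdegree_less p q n \<Longrightarrow> f + h \<in> zdegree_less p q n"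
| scale: "f \<in> zdegree_less p q n \<Longrightarrow> const3 c * f \<in> zdegree_less p q n"
| mult: "f \<in> zdegree_less p q n \<Longrightarrow> m < 2 \<Longrightarrow> affine_coords p q m * f \<in> zdegree_less p q n"

lemma zdegree_less_mono: "f \<in> zdegree_less p q n \<Longrightarrow> n \<le> m \<Longrightarrow> f \<in> zdegree_less p q m"
  by (induction rule: zdegree_less.induct) (auto intro: zdegree_less.intros)

lemma zdegree_less_z: "f \<in> zdegree_less p q n \<Longrightarrow> var3 2 * f \<in> zdegree_less p q (Suc n)"
proof (induction rule: zdegree_less.induct)
  case (pow i)
  then have "var3 2 ^ Suc i \<in> zdegree_less p q (Suc n)" by (intro zdegree_less.pow) simp
  then show ?case by simp
next
  case (scale f c)
  then show ?case using zdegree_less.scale[of "var3 2 * f"] by (simp add: mult.left_commute)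
next
  case (mult f m)
  then show ?case using zdegree_less.mult[of "var3 2 * f"] by (simp add: mult.left_commute)
qed (auto simp: distrib_left intro: zdegree_less.intros)

text \<open>In \<open>x = (x - p z) + p z\<close> only the second summand raises the degree in
  \<open>z\<close>; likewise for \<open>y\<close>.\<close>

lemma zdegree_less_xy:
  assumes "f \<in> zdegree_less p q n"
  shows "var3 0 * f \<in> zdegree_less p q (Suc n)" "var3 1 * f \<in> zdegree_less p q (Suc n)"
proof -
  have f: "f \<in> zdegree_less p q (Suc n)" using zdegree_less_mono[OF assms] by simp
  have z: "const3 c * (var3 2 * f) \<in> zdegree_less p q (Suc n)" for c
    by (intro zdegree_less.scale zdegree_less_z assms)
  have "affine_coords p q 0 * f + const3 p * (var3 2 * f) \<in> zdegree_less p q (Suc n)"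
    "affine_coords p q (Suc 0) * f + const3 q * (var3 2 * f) \<in> zdegree_less p q (Suc n)"
    by (intro zdegree_less.add z zdegree_less.mult f; simp)+
  then show "var3 0 * f \<in> zdegree_less p q (Suc n)" "var3 1 * f \<in> zdegree_less p q (Suc n)"
    by (simp_all add: left_diff_distrib mult.assoc)
qed

lemma zdegree_less_z_power:
  "f \<in> zdegree_less p q n \<Longrightarrow> var3 2 ^ j * f \<in> zdegree_less p q (n + j)"
  by (induction j) (auto simp: mult.assoc dest: zdegree_less_z)

lemma zdegree_less_sum: "(\<And>x. x \<in> A \<Longrightarrow> f x \<in> zdegree_less p q n) \<Longrightarrow> (\<Sum>x\<in>A. f x) \<in> zdegree_less p q n"
  by (induction A rule: infinite_finite_induct) (auto intro: zdegree_less.intros)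

text \<open>As \<open>x\<close> is \<open>p z\<close> plus the first coordinate, multiplication by
  \<open>x\<close> multiplies the leading coefficient by \<open>p\<close>; likewise for
  \<open>y\<close> and \<open>q\<close>.\<close>

lemma var_mult_leading:
  assumes "f - const3 c * var3 2 ^ n \<in> zdegree_less p q n"
  shows "var3 0 * f - const3 (p * c) * var3 2 ^ Suc n \<in> zdegree_less p q (Suc n)"
    "var3 1 * f - const3 (q * c) * var3 2 ^ Suc n \<in> zdegree_less p q (Suc n)"
proof -
  define l where "l = f - const3 c * var3 2 ^ n"
  have f: "f = const3 c * var3 2 ^ n + l" by (simp add: l_def)
  have l: "l \<in> zdegree_less p q n" using assms by (simp add: l_def)
  have "const3 c * (affine_coords p q 0 * var3 2 ^ n) + var3 0 * l \<in> zdegree_less p q (Suc n)"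
    "const3 c * (affine_coords p q (Suc 0) * var3 2 ^ n) + var3 1 * l \<in> zdegree_less p q (Suc n)"
    by (intro zdegree_less.add zdegree_less.scale zdegree_less.mult zdegree_less.pow zdegree_less_xy l; simp)+
  then show "var3 0 * f - const3 (p * c) * var3 2 ^ Suc n \<in> zdegree_less p q (Suc n)"
    "var3 1 * f - const3 (q * c) * var3 2 ^ Suc n \<in> zdegree_less p q (Suc n)"
    unfolding f const3_mult by (simp_all add: algebra_simps)
qed

lemma mon3_leading:
  "mon3 (a, b, c) - const3 (p ^ a * q ^ b) * var3 2 ^ (a + b + c) \<in> zdegree_less p q (a + b + c)"
proof (induction a)
  case 0
  show ?case
  proof (induction b)
    case 0
    show ?case by (simp add: mon3_def zdegree_less.zero)
  next
    case (Suc b)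
    from var_mult_leading(2)[OF Suc] show ?case by (simp add: mon3_def mult.assoc)
  qed
next
  case (Suc a)
  from var_mult_leading(1)[OF Suc] show ?case by (simp add: mon3_def mult.assoc)
qed

lemma in_some_zdegree_less: "\<exists>n. f \<in> zdegree_less p q n"
proof (induction f rule: poly3_induct)
  case (add f h)
  then obtain n m where "f \<in> zdegree_less p q n" "h \<in> zdegree_less p q m" by blast
  then have "f + h \<in> zdegree_less p q (max n m)"
    by (intro zdegree_less.add) (auto intro: zdegree_less_mono)
  then show ?case by blast
next
  case one
  have "var3 2 ^ 0 \<in> zdegree_less p q 1" by (rule zdegree_less.pow) simp
  then show ?case by auto
next
  case (var i f)
  then show ?case using exhaust_three[of i] zdegree_less_xy zdegree_less_z by metis
qed (auto intro: zdegree_less.scale)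

text \<open>The monomials of degree at most \<open>r\<close> outnumber the dimension of the
  quotient, so they are linearly dependent modulo \<open>I\<close>.\<close>

lemma (in finite_colength) exists_relation:
  assumes "card B < (r + 3) choose 3"
  shows "\<exists>u. u \<in> fspace (simplex3 r) \<and> u \<noteq> 0 \<and> (\<Sum>\<alpha>\<in>simplex3 r. const3 (u \<alpha>) * mon3 \<alpha>) \<in> I"
proof (rule ccontr)
  assume contra: "\<not> ?thesis"
  define ev where "ev u = coords (\<Sum>\<alpha>\<in>simplex3 r. const3 (u \<alpha>) * mon3 \<alpha>)" for u
  have lin: "Vector_Spaces.linear fscale fscale ev"
    by (rule fs_linearI) (simp_all add: ev_def coords_sum coords_scale fs.scale_left_distrib
        sum.distrib fs.scale_sum_right)
  have "fs.dim (fspace (simplex3 r) :: (nat \<times> nat \<times> nat \<Rightarrow> 'k) set) \<le> fs.dim (fspace B :: ('i \<Rightarrow> 'k) set)"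
    by (rule fs_dim_le_inj[OF lin subspace_fspace _ _ subset_refl finite_B])
      (use contra in \<open>auto simp: ev_def coords_in coords_eq_0_iff\<close>)
  then show False using assms by (simp add: dim_fspace finite_B finite_simplex3 card_simplex3)
qed

text \<open>
  In general coordinates, an element of \<open>I\<close> of degree \<open>s\<close> is monic of degree \<open>s\<close> in the last variable
  up to a scalar.
\<close>

lemma (in finite_colength) exists_generators:
  assumes inf: "infinite (UNIV :: 'k set)" and "card B < (r + 3) choose 3"
  shows "\<exists>g s. s \<le> r \<and> finite_colength_generators I B coords e g s"
proof -
  obtain u where u: "u \<in> fspace (simplex3 r)" "u \<noteq> 0"
    "(\<Sum>\<alpha>\<in>simplex3 r. const3 (u \<alpha>) * mon3 \<alpha>) \<in> I"
    using exists_relation assms(2) by blast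
  define deg where "deg = (\<lambda>(a, b, c). a + b + c :: nat)"
  \<comment> \<open>The degree of the relation, which may be smaller than \<open>r\<close>.\<close>
  define s where "s = Max (deg ` {\<alpha> \<in> simplex3 r. u \<alpha> \<noteq> 0})"
  have fin: "finite {\<alpha> \<in> simplex3 r. u \<alpha> \<noteq> 0}" using finite_simplex3 by simp
  have "{\<alpha> \<in> simplex3 r. u \<alpha> \<noteq> 0} \<noteq> {}"
  proof -
    obtain \<alpha> where "u \<alpha> \<noteq> 0" using u(2) by (auto simp: fun_eq_iff)
    then show ?thesis using u(1) unfolding fspace_def by blast
  qed
  then have "s \<in> deg ` {\<alpha> \<in> simplex3 r. u \<alpha> \<noteq> 0}" unfolding s_def using fin by (intro Max_in) auto
  then obtain a0 b0 c0 where top: "(a0, b0, c0) \<in> simplex3 r" "u (a0, b0, c0) \<noteq> 0" "a0 + b0 + c0 = s"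
    by (auto simp: deg_def)
  have s_max: "deg \<alpha> \<le> s" if "\<alpha> \<in> simplex3 r" "u \<alpha> \<noteq> 0" for \<alpha>
    unfolding s_def using fin that by (intro Max_ge) auto
  have s_le: "s \<le> r" using top by (auto simp: simplex3_def)
  \<comment> \<open>The coefficients of the top form after setting \<open>z = 1\<close>; its degree
    \<open>s\<close> fixes the exponent of \<open>z\<close>.\<close>
  define v where "v a b = (if a + b \<le> s then u (a, b, s - a - b) else 0)" for a b
  have v0: "v a0 b0 \<noteq> 0" "a0 \<le> s" "b0 \<le> s"
  proof -
    have "s - a0 - b0 = c0" using top(3) by simp
    then show "v a0 b0 \<noteq> 0" "a0 \<le> s" "b0 \<le> s" using top by (auto simp: v_def)
  qed
  \<comment> \<open>The shear is chosen so that the top form does not vanish at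
    \<open>(p, q, 1)\<close>.\<close>
  obtain p q where pq: "(\<Sum>a\<le>s. \<Sum>b\<le>s. v a b * p ^ a * q ^ b) \<noteq> 0"
    using poly2_nonvanishing[where u = v, OF inf v0] by blast
  \<comment> \<open>The top form at \<open>(p, q, 1)\<close>, that is, the coefficient of
    \<open>z^s\<close> in the sheared coordinates.\<close>
  define F where "F = (\<Sum>(a, b, c)\<in>{\<alpha> \<in> simplex3 r. deg \<alpha> = s}. u (a, b, c) * p ^ a * q ^ b)"
  have "F = (\<Sum>(a, b)\<in>{(a, b). a + b \<le> s}. v a b * p ^ a * q ^ b)"
    unfolding F_def
    by (rule sum.reindex_bij_witness[of _ "\<lambda>(a, b). (a, b, s - a - b)" "\<lambda>(a, b, c). (a, b)"])
      (use s_le in \<open>auto simp: simplex3_def deg_def v_def\<close>)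
  also have "\<dots> = (\<Sum>(a, b)\<in>{..s} \<times> {..s}. v a b * p ^ a * q ^ b)"
    by (rule sum.mono_neutral_left) (auto simp: v_def split: if_splits)
  finally have F: "F \<noteq> 0" using pq by (simp add: sum.cartesian_product)
  define f where "f = (\<Sum>\<alpha>\<in>simplex3 r. const3 (u \<alpha>) * mon3 \<alpha>)"
  \<comment> \<open>The contribution of a monomial to \<open>z^s\<close>; a monomial of degree below
    \<open>s\<close> makes none.\<close>
  define w where "w \<alpha> = (if deg \<alpha> = s then case \<alpha> of (a, b, c) \<Rightarrow> const3 (u \<alpha> * p ^ a * q ^ b) * var3 2 ^ s else 0)" for \<alpha>
  have summand: "const3 (u \<alpha>) * mon3 \<alpha> - w \<alpha>
      \<in> zdegree_less p q s" if \<alpha>: "\<alpha> \<in> simplex3 r" for \<alpha>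
  proof -
    obtain a b c where abc: "\<alpha> = (a, b, c)" by (cases \<alpha>)
    define l where "l = mon3 (a, b, c) - const3 (p ^ a * q ^ b) * var3 2 ^ (a + b + c)"
    have l: "l \<in> zdegree_less p q (a + b + c)"
      unfolding l_def by (rule mon3_leading)
    have l': "const3 (u \<alpha>) * l \<in> zdegree_less p q (a + b + c)"
      by (rule zdegree_less.scale[OF l])
    have m: "mon3 \<alpha> = const3 (p ^ a * q ^ b) * var3 2 ^ (a + b + c) + l" by (simp add: l_def abc)
    consider "u \<alpha> = 0" | "deg \<alpha> = s" | "deg \<alpha> < s" using s_max[OF \<alpha>] by fastforce
    then show ?thesis
    proof cases
      case 1
      then show ?thesis by (auto simp: w_def zdegree_less.zero split: prod.split)
    next
      case 2
      then show ?thesis using l' unfolding m by (simp add: w_def abc deg_def const3_mult algebra_simps)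
    next
      case 3
      have "const3 (u \<alpha>) * mon3 \<alpha> \<in> zdegree_less p q s"
        unfolding m distrib_left using 3 l
        by (intro zdegree_less.add zdegree_less.scale zdegree_less.pow)
          (auto simp: abc deg_def intro: zdegree_less_mono)
      then show ?thesis using 3 by (simp add: w_def)
    qed
  qed
  have "(\<Sum>\<alpha>\<in>simplex3 r. w \<alpha>)
    = (\<Sum>(a, b, c)\<in>{\<alpha> \<in> simplex3 r. deg \<alpha> = s}. const3 (u (a, b, c) * p ^ a * q ^ b) * var3 2 ^ s)"
    by (subst sum.inter_filter[OF finite_simplex3]) (auto simp: w_def intro!: sum.cong)
  also have "\<dots> = const3 F * var3 2 ^ s"
  proof -
    have "const3 (\<Sum>x\<in>A. h x) = (\<Sum>x\<in>A. const3 (h x))" for h :: "nat \<times> nat \<times> nat \<Rightarrow> 'k" and A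
      by (induction A rule: infinite_finite_induct) (auto simp: const3_add)
    then show ?thesis by (simp add: F_def sum_distrib_right case_prod_unfold)
  qed
  finally have lead: "f - const3 F * var3 2 ^ s \<in> zdegree_less p q s"
    using zdegree_less_sum[of "simplex3 r" "\<lambda>\<alpha>. const3 (u \<alpha>) * mon3 \<alpha> - w \<alpha>", OF summand]
    by (simp add: sum_subtractf f_def)
  have "finite_colength_generators I B coords e (affine_coords p q) s"
  proof (unfold_locales, goal_cases)
    case (1 P f)
    show ?case
    proof (induction f rule: poly3_induct)
      case (var i f)
      have z: "P (var3 2 * f)" using 1(4)[of 2 f] var by simp
      have "P (affine_coords p q 0 * f + const3 p * (var3 2 * f))"
        "P (affine_coords p q (Suc 0) * f + const3 q * (var3 2 * f))"
        by (intro 1(1) 1(2) 1(4) z var; simp)+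
      then show ?case using z exhaust_three[of i] by (auto simp: left_diff_distrib mult.assoc)
    qed (use 1 in auto)
  next
    case (2 P h)
    \<comment> \<open>Every polynomial has some bound on its degree in \<open>z\<close>, so strong
      induction on that bound suffices.\<close>
    have "P h" if "h \<in> zdegree_less p q n" for n h
      using that
    proof (induction n arbitrary: h rule: less_induct)
      case (less n)
      have z: "P (var3 2 ^ i)" if i: "i < n" for i
      proof (cases "i < s")
        case True
        then show ?thesis using 2(4)[of i] by simp
      next
        case False
        \<comment> \<open>For \<open>i \<ge> s\<close> the power \<open>z^i\<close> is a scalar
          multiple of the difference of \<open>z^(i - s) * f\<close>, which lies in
          \<open>I\<close>, and \<open>z^(i - s) * l\<close>, to which the induction hypothesis
          applies.\<close>
        define l where "l = f - const3 F * var3 2 ^ s"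
        have "var3 2 ^ (i - s) * l \<in> zdegree_less p q (s + (i - s))"
          using lead unfolding l_def by (rule zdegree_less_z_power)
        then have "P (var3 2 ^ (i - s) * l)" using less.IH[of i] i False by simp
        moreover have "P (var3 2 ^ (i - s) * f)" using u(3) by (intro 2(3) I_mult) (simp add: f_def)
        ultimately have "P (const3 (inverse F) * (var3 2 ^ (i - s) * f + const3 (- 1) * (var3 2 ^ (i - s) * l)))"
          by (intro 2(1) 2(2))
        also have "const3 (- 1) = (- 1 :: 'k poly3)"
          by (simp add: const3_def single_uminus)
        also have "const3 (inverse F) * (var3 2 ^ (i - s) * f + - 1 * (var3 2 ^ (i - s) * l)) =
            const3 (inverse F) * const3 F * (var3 2 ^ (i - s) * var3 2 ^ s)"
          by (simp add: l_def algebra_simps)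
        also have "\<dots> = var3 2 ^ i"
          using F False by (simp flip: const3_mult power_add)
        finally show ?thesis .
      qed
      from less.prems show ?case
      proof (induction rule: zdegree_less.induct)
        case zero
        have "P (const3 0 * 0)" by (intro 2(2) 2(3) I_0)
        then show ?case by simp
      qed (use 2 z in auto)
    qed
    then show ?case using in_some_zdegree_less by blast
  qed
  with s_le show ?thesis by blast
qed

section \<open>Comparison with the modules of tangent vectors\<close>

text \<open>The bridge between vector spaces given as records and the function spaces
  \<open>fspace\<close>.\<close>

locale class_ring_vectorspace = vectorspace class_ring V
  for V :: "('k::field, 'v, 'z) module_scheme"
begin

lemma lincomb_coeff_cong:
  assumes "S \<subseteq> carrier V" "\<And>v. v \<in> S \<Longrightarrow> a v = b v"
  shows "lincomb a S = lincomb b S"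
  unfolding lincomb_def using assms by (intro finsum_cong') (auto simp: class_ring_simps)

lemma lincomb_coeff_zero:
  assumes "S \<subseteq> carrier V" "\<And>v. v \<in> S \<Longrightarrow> a v = 0"
  shows "lincomb a S = \<zero>\<^bsub>V\<^esub>"
proof -
  have "lincomb a S = lincomb (\<lambda>w. 0 \<otimes>\<^bsub>class_ring\<^esub> a w) S"
    by (rule lincomb_coeff_cong) (use assms in \<open>auto simp: class_ring_simps\<close>)
  also have "\<dots> = 0 \<odot>\<^bsub>V\<^esub> lincomb a S"
    by (rule lincomb_smult) (use assms in \<open>auto simp: class_ring_simps\<close>)
  also have "\<dots> = \<zero>\<^bsub>V\<^esub>"
    using lmult_0[of "lincomb a S"] lincomb_closed[of S a] assms(1) by (simp add: class_ring_simps)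
  finally show ?thesis .
qed

lemma lincomb_funit:
  assumes "finite S" "S \<subseteq> carrier V" "b \<in> S"
  shows "lincomb (funit b) S = b"
proof -
  have "lincomb (funit b) (S - {b} \<union> {b}) = funit b b \<odot>\<^bsub>V\<^esub> b \<oplus>\<^bsub>V\<^esub> lincomb (funit b) (S - {b})"
    by (rule lincomb_insert) (use assms in \<open>auto simp: class_ring_simps\<close>)
  also have "lincomb (funit b) (S - {b}) = \<zero>\<^bsub>V\<^esub>"
    by (rule lincomb_coeff_zero) (use assms in \<open>auto simp: funit_def\<close>)
  also have "funit b b \<odot>\<^bsub>V\<^esub> b \<oplus>\<^bsub>V\<^esub> \<zero>\<^bsub>V\<^esub> = b"
    using assms smult_one[of b] by (auto simp: funit_def class_ring_simps)
  also have "S - {b} \<union> {b} = S" using assms by blast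
  finally show ?thesis .
qed

text \<open>The coefficients with respect to a finite basis, extended by 0 off the basis in order to
  lie in \<open>fspace \<beta>\<close>.\<close>

lemma obtain_coords:
  assumes fd: "fin_dim"
  obtains \<beta> and co :: "'v \<Rightarrow> 'v \<Rightarrow> 'k" where "finite \<beta>" "card \<beta> = dim" "\<beta> \<subseteq> carrier V"
    "\<And>x. co x \<in> fspace \<beta>"
    "\<And>x y. x \<in> carrier V \<Longrightarrow> y \<in> carrier V \<Longrightarrow> co (x \<oplus>\<^bsub>V\<^esub> y) = co x + co y"
    "\<And>c x. x \<in> carrier V \<Longrightarrow> co (c \<odot>\<^bsub>V\<^esub> x) = fscale c (co x)"
    "\<And>x. x \<in> carrier V \<Longrightarrow> co x = 0 \<longleftrightarrow> x = \<zero>\<^bsub>V\<^esub>"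
    "\<And>b. b \<in> \<beta> \<Longrightarrow> co b = funit b"
proof -
  obtain \<beta> where \<beta>: "finite \<beta>" "basis \<beta>" using finite_basis_exists fd by blast
  have sub: "\<beta> \<subseteq> carrier V" using \<beta>(2) by (simp add: basis_def)
  have ex1: "\<exists>!a. a \<in> \<beta> \<rightarrow>\<^sub>E (UNIV :: 'k set) \<and> lincomb a \<beta> = v" if "v \<in> carrier V" for v
    using basis_criterion[OF \<beta>(1) sub] \<beta>(2) that by (simp add: class_ring_simps)
  have unique: "a = b" if ab: "a \<in> fspace \<beta>" "b \<in> fspace \<beta>" "lincomb a \<beta> = lincomb b \<beta>"
    for a b :: "'v \<Rightarrow> 'k"
  proof -
    have r: "lincomb (restrict c \<beta>) \<beta> = lincomb c \<beta>" for c :: "'v \<Rightarrow> 'k"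
      by (rule lincomb_coeff_cong) (use sub in auto)
    have "lincomb b \<beta> \<in> carrier V" using sub by (intro lincomb_closed) (auto simp: class_ring_simps)
    note e = ex1[OF this]
    have "restrict a \<beta> \<in> \<beta> \<rightarrow>\<^sub>E UNIV \<and> lincomb (restrict a \<beta>) \<beta> = lincomb b \<beta>"
      "restrict b \<beta> \<in> \<beta> \<rightarrow>\<^sub>E UNIV \<and> lincomb (restrict b \<beta>) \<beta> = lincomb b \<beta>"
      using ab(3) r by simp_all
    with e have "restrict a \<beta> = restrict b \<beta>" by blast
    then have "a x = b x" if "x \<in> \<beta>" for x using that by (metis restrict_apply')
    moreover have "a x = b x" if "x \<notin> \<beta>" for x using that ab(1,2) by (simp add: fspace_def)
    ultimately show ?thesis by blast
  qed
  have ex: "\<exists>a :: 'v \<Rightarrow> 'k. a \<in> fspace \<beta> \<and> lincomb a \<beta> = v" if v: "v \<in> carrier V" for v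
  proof -
    obtain a where a: "lincomb a \<beta> = v" using ex1[OF v] by blast
    let ?a = "\<lambda>x. if x \<in> \<beta> then a x else 0"
    have "lincomb ?a \<beta> = v" unfolding a[symmetric] by (rule lincomb_coeff_cong) (use sub in auto)
    then show ?thesis by (intro exI[of _ ?a]) (simp add: fspace_def)
  qed
  \<comment> \<open>The default 0 keeps \<open>co x\<close> in \<open>fspace \<beta>\<close> even
    for \<open>x\<close> outside the carrier.\<close>
  define co where "co x = (if x \<in> carrier V then SOME a :: 'v \<Rightarrow> 'k. a \<in> fspace \<beta> \<and> lincomb a \<beta> = x else 0)" for x
  have co: "co x \<in> fspace \<beta>" "lincomb (co x) \<beta> = x" if "x \<in> carrier V" for x
    using someI_ex[OF ex[OF that]] that by (simp_all add: co_def)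
  have coI: "co x = a" if "a \<in> fspace \<beta>" "lincomb a \<beta> = x" for x a
  proof -
    have "x \<in> carrier V" using that sub by (auto simp: class_ring_simps)
    then show ?thesis using unique co that by blast
  qed
  show ?thesis
  proof (rule that[of \<beta> co])
    show "card \<beta> = dim" using dim_basis \<beta> by simp
  next
    fix x
    show "co x \<in> fspace \<beta>"
      using co(1)[of x] by (cases "x \<in> carrier V") (auto simp: co_def fs.subspace_0[OF subspace_fspace])
  next
    fix c x assume x: "x \<in> carrier V"
    show "co (c \<odot>\<^bsub>V\<^esub> x) = fscale c (co x)"
    proof (rule coI)
      show "fscale c (co x) \<in> fspace \<beta>" using co(1)[OF x] fs.subspace_scale[OF subspace_fspace] by blast
      show "lincomb (fscale c (co x)) \<beta> = c \<odot>\<^bsub>V\<^esub> x"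
        using lincomb_smult[OF sub, of "co x" c] co(2)[OF x] by (simp add: class_ring_simps fscale_def)
    qed
  next
    fix x y assume x: "x \<in> carrier V" and y: "y \<in> carrier V"
    show "co (x \<oplus>\<^bsub>V\<^esub> y) = co x + co y"
    proof (rule coI)
      show "co x + co y \<in> fspace \<beta>" using co(1) x y fs.subspace_add[OF subspace_fspace] by blast
      show "lincomb (co x + co y) \<beta> = x \<oplus>\<^bsub>V\<^esub> y"
        using lincomb_sum[OF \<beta>(1) sub, of "co x" "co y"] co(2) x y by (simp add: class_ring_simps plus_fun_def)
    qed
  next
    fix x assume x: "x \<in> carrier V"
    have "co \<zero>\<^bsub>V\<^esub> = 0"
      by (rule coI) (use lincomb_coeff_zero[OF sub, of 0] fs.subspace_0[OF subspace_fspace] in auto)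
    moreover have "x = \<zero>\<^bsub>V\<^esub>" if "co x = 0"
      using co(2)[OF x] lincomb_coeff_zero[OF sub, of "co x"] that by simp
    ultimately show "co x = 0 \<longleftrightarrow> x = \<zero>\<^bsub>V\<^esub>" by auto
  next
    fix b assume "b \<in> \<beta>"
    then show "co b = funit b"
      by (intro coI lincomb_funit \<beta> sub) (auto simp: fspace_def funit_def)
  qed (use \<beta> sub in auto)
qed

text \<open>A basis of the image of \<open>E\<close> pulls back to a basis of \<open>V\<close>, so
  the dimension of the record can be computed among functions.\<close>

lemma dim_eq_embedding:
  fixes E :: "'v \<Rightarrow> 'j \<Rightarrow> 'k"
  assumes add: "\<And>x y. x \<in> carrier V \<Longrightarrow> y \<in> carrier V \<Longrightarrow> E (x \<oplus>\<^bsub>V\<^esub> y) = E x + E y"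
    and scale: "\<And>c x. x \<in> carrier V \<Longrightarrow> E (c \<odot>\<^bsub>V\<^esub> x) = fscale c (E x)"
    and inj: "\<And>x. x \<in> carrier V \<Longrightarrow> E x = 0 \<Longrightarrow> x = \<zero>\<^bsub>V\<^esub>"
    and sub: "E ` carrier V \<subseteq> fspace \<Omega>" and fin: "finite \<Omega>"
  shows "fin_dim" "dim = fs.dim (E ` carrier V)"
proof -
  have E_zero: "E \<zero>\<^bsub>V\<^esub> = 0" using add[of "\<zero>\<^bsub>V\<^esub>" "\<zero>\<^bsub>V\<^esub>"] by simp
  have E_inj: "x = y" if xy: "x \<in> carrier V" "y \<in> carrier V" "E x = E y" for x y
  proof -
    \<comment> \<open>The difference is written as \<open>x\<close> plus \<open>- 1\<close> times
      \<open>y\<close>, because \<open>E\<close> is only known to respect sums and scalar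
      multiples.\<close>
    have m: "(- 1) \<odot>\<^bsub>V\<^esub> y \<in> carrier V" using xy(2) by (simp add: class_ring_simps)
    have "E (x \<oplus>\<^bsub>V\<^esub> (- 1) \<odot>\<^bsub>V\<^esub> y) = 0" using add[OF xy(1) m] scale[OF xy(2), of "- 1"] xy(3) by simp
    then have 1: "x \<oplus>\<^bsub>V\<^esub> (- 1) \<odot>\<^bsub>V\<^esub> y = \<zero>\<^bsub>V\<^esub>" using inj xy(1) m by simp
    have "(- 1) \<odot>\<^bsub>V\<^esub> y \<oplus>\<^bsub>V\<^esub> y = ((- 1) \<oplus>\<^bsub>class_ring\<^esub> 1) \<odot>\<^bsub>V\<^esub> y"
      using smult_l_distr[of "- 1" 1 y] smult_one[of y] xy(2) by (simp add: class_ring_simps)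
    then have "(- 1) \<odot>\<^bsub>V\<^esub> y \<oplus>\<^bsub>V\<^esub> y = \<zero>\<^bsub>V\<^esub>" using lmult_0[of y] xy(2) by (simp add: class_ring_simps)
    then show "x = y" using 1 xy(1,2) m by (metis a_assoc l_zero r_zero)
  qed
  obtain C where C: "C \<subseteq> E ` carrier V" "fs.independent C" "E ` carrier V \<subseteq> fs.span C"
    "card C = fs.dim (E ` carrier V)"
    using fs.basis_exists by blast
  have finC: "finite C"
    using fs.independent_span_bound[OF _ C(2), of "funit ` \<Omega>"] C(1) sub fspace_span[OF fin] fin by blast
  obtain D where D: "D \<subseteq> carrier V" "inj_on E D" "C = E ` D"
    using C(1) by (meson subset_image_inj)
  have finD: "finite D" using finC D by (simp add: finite_image_iff)
  have E_lincomb: "E (lincomb a S) = (\<Sum>d\<in>S. fscale (a d) (E d))" if "finite S" "S \<subseteq> carrier V" for a S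
    using that
  proof (induction S rule: finite_induct)
    case empty
    then show ?case using E_zero lincomb_coeff_zero[of "{}" a] by simp
  next
    case (insert d S)
    then have "lincomb a (S \<union> {d}) = a d \<odot>\<^bsub>V\<^esub> d \<oplus>\<^bsub>V\<^esub> lincomb a S"
      by (intro lincomb_insert) (auto simp: class_ring_simps)
    moreover have "a d \<odot>\<^bsub>V\<^esub> d \<in> carrier V" "lincomb a S \<in> carrier V"
      using insert by (auto simp: class_ring_simps)
    ultimately show ?case using insert by (simp add: add scale)
  qed
  have "basis D"
    unfolding basis_criterion[OF finD D(1)]
  proof (intro allI impI)
    fix v assume v: "v \<in> carrier V"
    have "E v \<in> fs.span C" using C(3) v by blast
    then obtain u where u: "E v = (\<Sum>c\<in>C. fscale (u c) c)"
      using fs.span_finite[OF finC] by auto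
    have 1: "lincomb (\<lambda>d\<in>D. u (E d)) D = v"
    proof (rule E_inj)
      show "E (lincomb (\<lambda>d\<in>D. u (E d)) D) = E v"
        using E_lincomb[OF finD D(1)] u D(2,3) by (simp add: sum.reindex)
      show "lincomb (\<lambda>d\<in>D. u (E d)) D \<in> carrier V"
        by (rule lincomb_closed) (use D(1) in \<open>auto simp: class_ring_simps\<close>)
    qed (use v in simp)
    have 2: "a = b" if ab: "a \<in> D \<rightarrow>\<^sub>E UNIV" "b \<in> D \<rightarrow>\<^sub>E UNIV" "lincomb a D = lincomb b D" for a b :: "'v \<Rightarrow> 'k"
    proof (rule PiE_ext[OF ab(1,2)])
      fix d assume d: "d \<in> D"
      have "(\<Sum>d\<in>D. fscale (a d - b d) (E d)) = 0"
        using E_lincomb[OF finD D(1), of a] E_lincomb[OF finD D(1), of b] ab(3)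
        by (simp add: fs.scale_left_diff_distrib sum_subtractf)
      then have "(\<Sum>c\<in>C. fscale (a (inv_into D E c) - b (inv_into D E c)) c) = 0"
        using D(2,3) by (simp add: sum.reindex inv_into_f_f cong: sum.cong)
      then have "a (inv_into D E (E d)) - b (inv_into D E (E d)) = 0"
        by (rule fs.independentD[OF C(2) finC subset_refl]) (use d D(3) in blast)
      then show "a d = b d" using d D(2) by (simp add: inv_into_f_f)
    qed
    show "\<exists>!a. a \<in> D \<rightarrow>\<^sub>E carrier class_ring \<and> lincomb a D = v"
    proof (rule ex1I[of _ "\<lambda>d\<in>D. u (E d)"])
      show "(\<lambda>d\<in>D. u (E d)) \<in> D \<rightarrow>\<^sub>E carrier class_ring \<and> lincomb (\<lambda>d\<in>D. u (E d)) D = v"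
        using 1 by (simp add: class_ring_simps)
    qed (use 1 2 in \<open>auto simp: class_ring_simps\<close>)
  qed
  then show "fin_dim" "dim = fs.dim (E ` carrier V)"
    using dim_basis[OF finD] finD D C(4) card_image[OF D(2)] by (auto simp: fin_dim_def basis_def)
qed

end

section \<open>Cosets of an ideal and homomorphisms into the quotient\<close>

locale poly3_ideal =
  fixes I :: "'k::field poly3 set"
  assumes ideal: "ideal I poly3_ring"
begin

sublocale ideal I poly3_ring by (rule ideal)

abbreviation Q :: "'k poly3 set ring" where "Q \<equiv> poly3_ring Quot I"

definition coset :: "'k poly3 \<Rightarrow> 'k poly3 set" where
  "coset f = I +>\<^bsub>poly3_ring\<^esub> f"

lemma I_closed: "f \<in> I \<Longrightarrow> g \<in> I \<Longrightarrow> f + g \<in> I" "f \<in> I \<Longrightarrow> h * f \<in> I" "0 \<in> I" "f \<in> I \<Longrightarrow> - f \<in> I"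
proof -
  show "f \<in> I \<Longrightarrow> g \<in> I \<Longrightarrow> f + g \<in> I" using a_closed by (simp add: class_ring_simps)
  show m: "f \<in> I \<Longrightarrow> h * f \<in> I" for h f using I_l_closed by (simp add: class_ring_simps)
  show "0 \<in> I" using zero_closed by (simp add: class_ring_simps)
  show "f \<in> I \<Longrightarrow> - f \<in> I" using m[of f "- 1"] by simp
qed

lemma coset_hom:
  "coset f \<in> carrier Q" "coset (f + g) = coset f \<oplus>\<^bsub>Q\<^esub> coset g"
  "coset (f * g) = coset f \<otimes>\<^bsub>Q\<^esub> coset g" "coset 0 = \<zero>\<^bsub>Q\<^esub>"
proof -
  interpret h: ring_hom_ring poly3_ring Q "(+>\<^bsub>poly3_ring\<^esub>) I"
    by (rule rcos_ring_hom_ring)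
  show "coset f \<in> carrier Q" "coset (f + g) = coset f \<oplus>\<^bsub>Q\<^esub> coset g"
    "coset (f * g) = coset f \<otimes>\<^bsub>Q\<^esub> coset g" "coset 0 = \<zero>\<^bsub>Q\<^esub>"
    using h.hom_closed[of f] h.hom_add[of f g] h.hom_mult[of f g] h.hom_zero
    by (simp_all add: coset_def class_ring_simps)
qed

lemma coset_image: "coset f = (\<lambda>i. i + f) ` I"
  by (auto simp: coset_def a_r_coset_def r_coset_def class_ring_simps)

lemma coset_eq_iff: "coset f = coset g \<longleftrightarrow> f - g \<in> I"
proof
  assume "coset f = coset g"
  moreover have "f \<in> coset f" unfolding coset_image using I_closed(3) by force
  ultimately show "f - g \<in> I" unfolding coset_image by force
next
  assume *: "f - g \<in> I"
  show "coset f = coset g"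
  proof -
    have "i + f \<in> (\<lambda>i. i + g) ` I" if "i \<in> I" for i
      using I_closed(1)[OF that *] by (intro image_eqI[of _ _ "i + (f - g)"]) auto
    moreover have "i + g \<in> (\<lambda>i. i + f) ` I" if "i \<in> I" for i
      using I_closed(1)[OF that I_closed(4)[OF *]] by (intro image_eqI[of _ _ "i + (- (f - g))"]) auto
    ultimately show ?thesis unfolding coset_image by blast
  qed
qed

definition rep :: "'k poly3 set \<Rightarrow> 'k poly3" where
  "rep C = (SOME f. C = coset f)"

lemma coset_rep: "C \<in> carrier Q \<Longrightarrow> coset (rep C) = C"
proof -
  assume "C \<in> carrier Q"
  then have "\<exists>f. C = coset f" by (auto simp: FactRing_def A_RCOSETS_def' coset_def)
  then show ?thesis unfolding rep_def by (metis (mono_tags) someI_ex)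
qed

lemma rep_coset: "rep (coset f) - f \<in> I"
  using coset_rep[OF coset_hom(1)[of f]] by (simp add: coset_eq_iff)

lemma quotient_space3_simps:
  "carrier (quotient_space3 I) = carrier Q" "C \<oplus>\<^bsub>quotient_space3 I\<^esub> D = C \<oplus>\<^bsub>Q\<^esub> D"
  "\<zero>\<^bsub>quotient_space3 I\<^esub> = \<zero>\<^bsub>Q\<^esub>" "c \<odot>\<^bsub>quotient_space3 I\<^esub> C = coset (const3 c) \<otimes>\<^bsub>Q\<^esub> C"
  by (simp_all add: quotient_space3_def restrict_scalars_def quotient_module_def coset_def)

text \<open>Coordinates on the quotient are composed with the coset map, and representatives of the
  basis cosets serve as the \<open>e i\<close>.\<close>

lemma exists_finite_colength:
  assumes "vectorspace.fin_dim class_ring (quotient_space3 I)"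
  shows "\<exists>(B :: 'k poly3 set set) coords e. finite_colength I B coords e \<and>
    card B = vectorspace.dim class_ring (quotient_space3 I)"
proof -
  interpret V: class_ring_vectorspace "quotient_space3 I"
    unfolding class_ring_vectorspace_def by (rule vectorspace_quotient_space3[OF ideal])
  show ?thesis
  proof (rule V.obtain_coords[OF assms], goal_cases)
    case (1 \<beta> co)
    note co = 1
    note co' = co(3-)[unfolded quotient_space3_simps]
    have "finite_colength I \<beta> (\<lambda>f. co (coset f)) rep"
    proof
      show "finite \<beta>" by fact
      show "co (coset f) \<in> fspace \<beta>" for f by (rule co(4))
      show "co (coset (f + g)) = co (coset f) + co (coset g)" for f g
        by (simp add: coset_hom co')
      show "co (coset (const3 c * f)) = fscale c (co (coset f))" for c f
        by (simp add: coset_hom co')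
      show "co (coset f) = 0 \<longleftrightarrow> f \<in> I" for f
        using coset_eq_iff[of f 0] by (simp add: co' coset_hom)
      show "co (coset (rep b)) = funit b" if "b \<in> \<beta>" for b
        using that co'(1) co(8) by (auto simp: coset_rep subset_iff)
      show "g * f \<in> I" if "f \<in> I" for f g using that by (rule I_closed)
    qed
    then show ?thesis using co(2) by blast
  qed
qed

lemma tangent_space3_simps:
  "\<phi> \<in> carrier (tangent_space3 I) \<longleftrightarrow> \<phi> \<in> extensional I \<and> (\<forall>f\<in>I. \<phi> f \<in> carrier Q) \<and>
     (\<forall>f\<in>I. \<forall>g\<in>I. \<phi> (f + g) = \<phi> f \<oplus>\<^bsub>Q\<^esub> \<phi> g) \<and> (\<forall>h. \<forall>f\<in>I. \<phi> (h * f) = coset h \<otimes>\<^bsub>Q\<^esub> \<phi> f)"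
  "\<phi> \<oplus>\<^bsub>tangent_space3 I\<^esub> \<psi> = (\<lambda>f\<in>I. \<phi> f \<oplus>\<^bsub>Q\<^esub> \<psi> f)"
  "c \<odot>\<^bsub>tangent_space3 I\<^esub> \<phi> = (\<lambda>f\<in>I. coset (const3 c) \<otimes>\<^bsub>Q\<^esub> \<phi> f)"
  "\<zero>\<^bsub>tangent_space3 I\<^esub> = (\<lambda>f\<in>I. \<zero>\<^bsub>Q\<^esub>)"
  by (auto simp: tangent_space3_def restrict_scalars_def hom_module_def quotient_module_def ideal_module_def
    LinearCombinations.module_hom_def coset_def class_ring_simps)

end

section \<open>The tangent space as a space of cocycles\<close>

locale finite_colength_ideal = poly3_ideal I + finite_colength_generators I B coords e g s
  for I :: "'k::field poly3 set" and B :: "'i set" and coords e g s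
begin

lemma coords_rep: "coords (rep (coset f)) = coords f"
  using rep_coset[of f] coords_diff[of "rep (coset f)" f] coords_eq_0_iff[of "rep (coset f) - f"] by simp

definition hom_coords :: "('k poly3 \<Rightarrow> 'k poly3 set) \<Rightarrow> 'k poly3 \<Rightarrow> 'i \<Rightarrow> 'k" where
  "hom_coords \<phi> f = coords (rep (\<phi> f))"

lemma hom_coords_add:
  "\<phi> f \<in> carrier Q \<Longrightarrow> \<psi> h \<in> carrier Q \<Longrightarrow> coords (rep (\<phi> f \<oplus>\<^bsub>Q\<^esub> \<psi> h)) = hom_coords \<phi> f + hom_coords \<psi> h"
  unfolding hom_coords_def using coords_rep[of "rep (\<phi> f) + rep (\<psi> h)"]
  by (simp add: coset_hom coset_rep coords_add)

lemma hom_coords_mult: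
  "\<phi> f \<in> carrier Q \<Longrightarrow> coords (rep (coset h \<otimes>\<^bsub>Q\<^esub> \<phi> f)) = mapply B (mult_matrix h) (hom_coords \<phi> f)"
  unfolding hom_coords_def using coords_rep[of "h * rep (\<phi> f)"]
  by (simp add: coset_hom coset_rep mapply_mult_matrix)

lemma mapply_const3: "v \<in> fspace B \<Longrightarrow> mapply B (mult_matrix (const3 c)) v = fscale c v"
  using mapply_mult_matrix[of "const3 c" "lift_coords v"] by (simp add: coords_lift coords_scale)

lemma tangent_hom_coords:
  assumes "\<phi> \<in> carrier (tangent_space3 I)"
  shows "tangent (hom_coords \<phi>)"
proof -
  have mem: "hom_coords \<phi> f \<in> fspace B" for f by (simp add: hom_coords_def coords_in)
  have mult: "hom_coords \<phi> (h * f) = mapply B (mult_matrix h) (hom_coords \<phi> f)" if "f \<in> I" for h f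
    using assms that hom_coords_mult[of \<phi> f h] by (simp add: tangent_space3_simps hom_coords_def)
  show ?thesis
    unfolding tangent_def
  proof (intro conjI ballI allI)
    fix f h assume "f \<in> I" "h \<in> I"
    then show "hom_coords \<phi> (f + h) = hom_coords \<phi> f + hom_coords \<phi> h"
      using assms hom_coords_add[of \<phi> f \<phi> h] by (simp add: tangent_space3_simps hom_coords_def)
  qed (simp_all add: mem mult mapply_const3)
qed

text \<open>Coordinate vectors are lifted back to cosets; cosets with equal coordinates are equal,
  which gives linearity.\<close>

lemma hom_of_tangent:
  assumes "tangent h"
  shows "\<exists>\<phi>\<in>carrier (tangent_space3 I). \<forall>f\<in>I. hom_coords \<phi> f = h f"
proof
  let ?\<phi> = "\<lambda>f\<in>I. coset (lift_coords (h f))"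
  note h = tangentD[OF assms]
  have eqI: "coset a = coset b" if "coords a = coords b" for a b
    using that coset_eq_iff[of a b] coords_diff[of a b] coords_eq_0_iff[of "a - b"] by simp
  show "?\<phi> \<in> carrier (tangent_space3 I)"
    unfolding tangent_space3_simps
  proof (intro conjI ballI allI)
    fix f h' assume f: "f \<in> I"
    show "?\<phi> (h' * f) = coset h' \<otimes>\<^bsub>Q\<^esub> ?\<phi> f"
      using f by (simp add: I_closed flip: coset_hom)
        (rule eqI, simp add: coords_lift h mapply_in_fspace mult_matrix_in flip: mapply_mult_matrix)
  qed (auto simp: I_closed coset_hom h lift_add)
  show "\<forall>f\<in>I. hom_coords ?\<phi> f = h f"
    by (simp add: hom_coords_def coords_rep coords_lift h)
qed

lemma cocycle_of_cong: "(\<And>f. f \<in> I \<Longrightarrow> h f = h' f) \<Longrightarrow> cocycle_of h = cocycle_of h'"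
  by (auto simp: cocycle_of_def fun_eq_iff remainder_in)

text \<open>The map \<open>\<phi> \<mapsto> cocycle_of (hom_coords \<phi>)\<close> is linear,
  injective by \<open>cocycle_of_inj\<close>, and has the stated image by
  \<open>hom_of_tangent\<close>.\<close>

lemma dim_tangent_space3:
  "vectorspace.dim class_ring (tangent_space3 I) = fs.dim (cocycle_of ` Collect tangent)"
proof -
  interpret V: class_ring_vectorspace "tangent_space3 I"
    unfolding class_ring_vectorspace_def by (rule vectorspace_tangent_space3[OF ideal])
  let ?E = "\<lambda>\<phi>. cocycle_of (hom_coords \<phi>)"
  have "?E ` carrier (tangent_space3 I) = cocycle_of ` Collect tangent"
  proof
    show "?E ` carrier (tangent_space3 I) \<subseteq> cocycle_of ` Collect tangent"
      using tangent_hom_coords by blast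
    show "cocycle_of ` Collect tangent \<subseteq> ?E ` carrier (tangent_space3 I)"
    proof clarify
      fix h assume "tangent h"
      then obtain \<phi> where \<phi>: "\<phi> \<in> carrier (tangent_space3 I)" "\<forall>f\<in>I. hom_coords \<phi> f = h f"
        using hom_of_tangent by blast
      then have "cocycle_of h = ?E \<phi>" by (intro cocycle_of_cong) simp
      then show "cocycle_of h \<in> ?E ` carrier (tangent_space3 I)" using \<phi>(1) by blast
    qed
  qed
  moreover have "V.dim = fs.dim (?E ` carrier (tangent_space3 I))"
  proof (rule V.dim_eq_embedding(2))
    fix \<phi> assume \<phi>: "\<phi> \<in> carrier (tangent_space3 I)"
    show "?E (c \<odot>\<^bsub>tangent_space3 I\<^esub> \<phi>) = fscale c (?E \<phi>)" for c
      unfolding cocycle_of_scale[symmetric]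
    proof (rule cocycle_of_cong)
      fix f assume "f \<in> I"
      then show "hom_coords (c \<odot>\<^bsub>tangent_space3 I\<^esub> \<phi>) f = fscale c (hom_coords \<phi> f)"
        using \<phi> hom_coords_mult[of \<phi> f "const3 c"]
        by (simp add: tangent_space3_simps hom_coords_def mapply_const3 coords_in)
    qed
    show "?E (\<phi> \<oplus>\<^bsub>tangent_space3 I\<^esub> \<psi>) = ?E \<phi> + ?E \<psi>" if \<psi>: "\<psi> \<in> carrier (tangent_space3 I)" for \<psi>
      unfolding cocycle_of_add[symmetric]
    proof (rule cocycle_of_cong)
      fix f assume "f \<in> I"
      then show "hom_coords (\<phi> \<oplus>\<^bsub>tangent_space3 I\<^esub> \<psi>) f = (hom_coords \<phi> + hom_coords \<psi>) f"
        using \<phi> \<psi> hom_coords_add[of \<phi> f \<psi> f] by (simp add: tangent_space3_simps hom_coords_def)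
    qed
    show "\<phi> = \<zero>\<^bsub>tangent_space3 I\<^esub>" if "?E \<phi> = 0"
    proof -
      have "\<phi> f = \<zero>\<^bsub>Q\<^esub>" if f: "f \<in> I" for f
      proof -
        have "coords (rep (\<phi> f)) = 0"
          using cocycle_of_inj[OF tangent_hom_coords[OF \<phi>] \<open>?E \<phi> = 0\<close> f] by (simp add: hom_coords_def)
        then have "coset (rep (\<phi> f)) = coset 0" by (simp add: coset_eq_iff flip: coords_eq_0_iff)
        then show ?thesis using \<phi> f by (simp add: tangent_space3_simps coset_rep coset_hom)
      qed
      then show ?thesis using \<phi> unfolding tangent_space3_simps
        by (intro extensionalityI[of _ I]) auto
    qed
  next
    show "?E ` carrier (tangent_space3 I) \<subseteq> fspace ({..<3} \<times> B \<times> B)"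
      using cocycle_of_in tangent_hom_coords by blast
  qed (use finite_B in simp)
  ultimately show ?thesis by simp
qed

lemma dim_tangent_space3_le:
  "vectorspace.dim class_ring (tangent_space3 I) \<le> (2 * s + 1) * card B"
  unfolding dim_tangent_space3 by (rule dim_cocycle_of)

end

section \<open>Powers of the maximal ideal\<close>

definition tdeg :: "(3 \<Rightarrow>\<^sub>0 nat) \<Rightarrow> nat" where
  "tdeg k = Poly_Mapping.lookup k 0 + Poly_Mapping.lookup k 1 + Poly_Mapping.lookup k 2"

lemma tdeg_add [simp]: "tdeg (k + l) = tdeg k + tdeg l"
  by (simp add: tdeg_def lookup_add)

lemma tdeg_0 [simp]: "tdeg 0 = 0"
  by (simp add: tdeg_def)

lemma tdeg_single [simp]: "tdeg (Poly_Mapping.single i n) = n"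
  using exhaust_three[of i] by (auto simp: tdeg_def lookup_single when_def)

lemma tdeg_eq_0_iff: "tdeg k = 0 \<longleftrightarrow> k = 0"
proof
  assume k: "tdeg k = 0"
  show "k = 0"
  proof (rule poly_mapping_eqI)
    fix i show "Poly_Mapping.lookup k i = Poly_Mapping.lookup 0 i"
      using exhaust_three[of i] k by (auto simp: tdeg_def)
  qed
qed simp

definition degree_slice :: "nat \<Rightarrow> (3 \<Rightarrow>\<^sub>0 nat) set" where
  "degree_slice r = {k. tdeg k = r}"

lemma degree_slice: "finite (degree_slice r)" "card (degree_slice r) = (r + 2) choose 2"
proof -
  let ?f = "\<lambda>k :: 3 \<Rightarrow>\<^sub>0 nat. (Poly_Mapping.lookup k 0, Poly_Mapping.lookup k 1, Poly_Mapping.lookup k 2)"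
  let ?g = "\<lambda>(a, b, c). Poly_Mapping.single (0::3) a + Poly_Mapping.single 1 b + Poly_Mapping.single 2 c"
  have "bij_betw ?f (degree_slice r) {(a, b, c). a + b + c = r}"
  proof (rule bij_betw_byWitness[where f' = ?g])
    show "\<forall>k\<in>degree_slice r. ?g (?f k) = k"
    proof
      fix k
      show "?g (?f k) = k"
      proof (rule poly_mapping_eqI)
        fix i show "Poly_Mapping.lookup (?g (?f k)) i = Poly_Mapping.lookup k i"
          using exhaust_three[of i] by (auto simp: lookup_add lookup_single when_def)
      qed
    qed
  qed (auto simp: degree_slice_def tdeg_def lookup_add lookup_single when_def)
  from bij_betw_finite[OF this] bij_betw_same_card[OF this]
  show "finite (degree_slice r)" "card (degree_slice r) = (r + 2) choose 2"
    using finite_card_slice[of r] by simp_all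
qed

text \<open>The \<open>r\<close>-th power of the maximal ideal, described by coefficients.\<close>

definition order_ge :: "nat \<Rightarrow> 'k::field poly3 set" where
  "order_ge r = {f. \<forall>k. Poly_Mapping.lookup f k \<noteq> 0 \<longrightarrow> r \<le> tdeg k}"

lemma order_geD: "f \<in> order_ge r \<Longrightarrow> tdeg k < r \<Longrightarrow> Poly_Mapping.lookup f k = 0"
  unfolding order_ge_def using leD by blast

lemma order_geI: "(\<And>k. tdeg k < r \<Longrightarrow> Poly_Mapping.lookup f k = 0) \<Longrightarrow> f \<in> order_ge r"
  unfolding order_ge_def using not_le_imp_less by blast

lemma order_ge_add: "f \<in> order_ge r \<Longrightarrow> g \<in> order_ge r \<Longrightarrow> f + g \<in> order_ge r"
  by (rule order_geI) (simp add: lookup_add order_geD)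

lemma order_ge_uminus: "f \<in> order_ge r \<Longrightarrow> - f \<in> order_ge r"
  by (auto simp: order_ge_def)

lemma order_ge_mult: "f \<in> order_ge r \<Longrightarrow> g \<in> order_ge s \<Longrightarrow> f * g \<in> order_ge (r + s)"
  unfolding order_ge_def
proof clarify
  fix k assume f: "\<forall>k. Poly_Mapping.lookup f k \<noteq> 0 \<longrightarrow> r \<le> tdeg k"
    and g: "\<forall>k. Poly_Mapping.lookup g k \<noteq> 0 \<longrightarrow> s \<le> tdeg k"
    and "Poly_Mapping.lookup (f * g) k \<noteq> 0"
  then have "k \<in> Poly_Mapping.keys (f * g)" by (simp add: in_keys_iff)
  then obtain a b where "k = a + b" "a \<in> Poly_Mapping.keys f" "b \<in> Poly_Mapping.keys g"
    using keys_mult[of f g] by blast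
  then show "r + s \<le> tdeg k" using f g by (auto simp: in_keys_iff intro: add_mono)
qed

lemma order_ge_0: "order_ge 0 = UNIV"
  by (simp add: order_ge_def)

lemma order_ge_single: "r \<le> tdeg k \<Longrightarrow> Poly_Mapping.single k v \<in> order_ge r"
  by (auto simp: order_ge_def lookup_single when_def)

lemma poly_mapping_sum_single:
  "f = (\<Sum>k\<in>Poly_Mapping.keys f. Poly_Mapping.single k (Poly_Mapping.lookup f k))"
  by (rule poly_mapping_eqI) (auto simp: lookup_sum lookup_single when_def in_keys_iff)

lemma ideal_order_ge: "ideal (order_ge r) poly3_ring"
proof (rule idealI)
  show "ring (poly3_ring :: 'a poly3 ring)" using cring.axioms(1)[OF cring_class_ring] .
  show "subgroup (order_ge r) (add_monoid (poly3_ring :: 'a poly3 ring))"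
  proof (rule group.subgroupI)
    show "Group.group (add_monoid (poly3_ring :: 'a poly3 ring))"
      using abelian_group.a_group[OF ring.is_abelian_group[OF cring.axioms(1)[OF cring_class_ring]]] .
    show "order_ge r \<noteq> ({} :: 'a poly3 set)" by (auto simp: order_ge_def intro!: exI[of _ 0])
    fix f g :: "'a poly3" assume f: "f \<in> order_ge r"
    show "inv\<^bsub>add_monoid poly3_ring\<^esub> f \<in> order_ge r"
    proof -
      have "inv\<^bsub>add_monoid poly3_ring\<^esub> f = - f"
        using abelian_group.minus_equality[OF ring.is_abelian_group[OF cring.axioms(1)[OF cring_class_ring]], of "- f" f]
        by (simp add: class_ring_simps a_inv_def)
      then show ?thesis using order_ge_uminus[OF f] by simp
    qed
    assume "g \<in> order_ge r"
    then show "f \<otimes>\<^bsub>add_monoid poly3_ring\<^esub> g \<in> order_ge r"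
      using f by (simp add: class_ring_simps order_ge_add)
  qed (simp add: class_ring_simps)
  fix f h :: "'a poly3" assume "f \<in> order_ge r"
  then show "h \<otimes>\<^bsub>poly3_ring\<^esub> f \<in> order_ge r" "f \<otimes>\<^bsub>poly3_ring\<^esub> h \<in> order_ge r"
    using order_ge_mult[of f r h 0] by (simp_all add: class_ring_simps order_ge_0 mult.commute)
qed

lemma max_ideal3_subset: "max_ideal3 \<subseteq> order_ge 1"
  unfolding max_ideal3_def
  by (rule ring.genideal_minimal[OF cring.axioms(1)[OF cring_class_ring] ideal_order_ge])
    (auto simp: var3_def intro!: order_ge_single)

lemma var3_in_max_ideal3: "var3 i \<in> max_ideal3"
proof -
  have "{var3 0, var3 1, var3 2} \<subseteq> (max_ideal3 :: 'a poly3 set)"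
    unfolding max_ideal3_def
    by (rule ring.genideal_self[OF cring.axioms(1)[OF cring_class_ring]]) (simp add: class_ring_simps)
  then show ?thesis using exhaust_three[of i] by auto
qed

text \<open>Orders add under multiplication; conversely, a monomial of degree greater than
  \<open>r\<close> splits off a variable and leaves degree at least \<open>r\<close>.\<close>

lemma max_ideal3_power_eq: "max_ideal3_power r = (order_ge r :: 'k::field poly3 set)"
proof (induction r)
  case 0
  show ?case by (simp add: max_ideal3_power_def order_ge_0 ideals_set_def class_ring_simps)
next
  case (Suc r)
  have "max_ideal3_power (Suc r) = ideal_prod poly3_ring (order_ge r) (max_ideal3 :: 'k poly3 set)"
  proof -
    have "monoid.mult (ideals_set R) = ideal_prod R" for R :: "'k poly3 ring" by (simp add: ideals_set_def)
    then show ?thesis unfolding Suc[symmetric] by (simp add: max_ideal3_power_def)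
  qed
  also have "\<dots> = order_ge (Suc r)"
  proof
    show "ideal_prod poly3_ring (order_ge r) (max_ideal3 :: 'k poly3 set) \<subseteq> order_ge (Suc r)"
    proof
      fix f :: "'k poly3" assume "f \<in> ideal_prod poly3_ring (order_ge r) max_ideal3"
      then show "f \<in> order_ge (Suc r)"
      proof induction
        case (prod i j)
        then show ?case using order_ge_mult[of i r j 1] max_ideal3_subset by (auto simp: class_ring_simps)
      qed (simp add: class_ring_simps order_ge_add)
    qed
  next
    let ?P = "ideal_prod poly3_ring (order_ge r) (max_ideal3 :: 'k poly3 set)"
    have single: "Poly_Mapping.single k v \<in> ?P" if "Suc r \<le> tdeg k" for k v
    proof -
      have "\<exists>i. Poly_Mapping.lookup k i > 0"
      proof (rule ccontr)
        assume "\<not> ?thesis"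
        then have "tdeg k = 0" by (simp add: tdeg_def)
        then show False using that by simp
      qed
      then obtain i where i: "Poly_Mapping.lookup k i > 0" ..
      let ?l = "k - Poly_Mapping.single i 1"
      have k: "k = ?l + Poly_Mapping.single i 1"
        by (rule poly_mapping_eqI) (use i in \<open>auto simp: lookup_add lookup_minus lookup_single when_def\<close>)
      then have "tdeg k = tdeg ?l + 1" by (metis tdeg_add tdeg_single)
      then have "Poly_Mapping.single ?l v \<in> order_ge r" using that by (intro order_ge_single) simp
      from ideal_prod.prod[OF this var3_in_max_ideal3[of i], where R = poly3_ring]
      show ?thesis using k by (simp add: class_ring_simps var3_def mult_single)
    qed
    have sum: "(\<Sum>k\<in>A. Poly_Mapping.single k (v k)) \<in> ?P" if "finite A" "\<And>k. k \<in> A \<Longrightarrow> Suc r \<le> tdeg k" for A v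
      using that
    proof (induction A rule: finite_induct)
      case empty
      \<comment> \<open>The empty sum is written as a monomial of admissible degree with coefficient
        0.\<close>
      have "tdeg (Poly_Mapping.single (0::3) (Suc r)) = Suc r" by simp
      then show ?case using single[of "Poly_Mapping.single (0::3) (Suc r)" 0] by simp
    next
      case (insert k A)
      then show ?case
        using ideal_prod.sum[OF single[of k "v k"], of "\<Sum>k\<in>A. Poly_Mapping.single k (v k)"]
        by (simp add: class_ring_simps)
    qed
    show "order_ge (Suc r) \<subseteq> ?P"
    proof
      fix f :: "'k poly3" assume f: "f \<in> order_ge (Suc r)"
      have "(\<Sum>k\<in>Poly_Mapping.keys f. Poly_Mapping.single k (Poly_Mapping.lookup f k)) \<in> ?P"
        by (rule sum) (use f in \<open>auto simp: order_ge_def in_keys_iff\<close>)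
      then show "f \<in> ?P" using poly_mapping_sum_single[of f] by simp
    qed
  qed
  finally show ?case .
qed

lemma lookup_const3_mult: "Poly_Mapping.lookup (const3 c * f) k = c * Poly_Mapping.lookup f k"
  unfolding const3_def mult_map_scale_conv_mult[symmetric]
  by (simp add: map.rep_eq when_def)

text \<open>The finitely many coefficients in degrees below \<open>r\<close> depend only on the
  coset and determine it.\<close>

lemma fin_dim_quotient_order_ge:
  "vectorspace.fin_dim class_ring (quotient_space3 (order_ge r :: 'k::field poly3 set))"
proof -
  interpret poly3_ideal "order_ge r :: 'k poly3 set"
    by (rule poly3_ideal.intro[OF ideal_order_ge])
  interpret V: class_ring_vectorspace "quotient_space3 (order_ge r :: 'k poly3 set)"
    unfolding class_ring_vectorspace_def by (rule vectorspace_quotient_space3[OF ideal])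
  let ?I = "order_ge r :: 'k poly3 set"
  let ?E = "\<lambda>C k. if tdeg k < r then Poly_Mapping.lookup (rep C) k else 0"
  have lookup_rep: "Poly_Mapping.lookup (rep (coset f)) k = Poly_Mapping.lookup f k" if "tdeg k < r" for f k
    using order_geD[OF rep_coset that, of f] by (simp add: lookup_minus)
  show ?thesis
  proof (rule V.dim_eq_embedding(1))
    fix C D assume C: "C \<in> carrier (quotient_space3 ?I)"
    then have C': "C \<in> carrier Q" by (simp add: quotient_space3_simps)
    show "?E (c \<odot>\<^bsub>quotient_space3 ?I\<^esub> C) = fscale c (?E C)" for c
      using lookup_rep[of _ "const3 c * rep C"] C'
      by (auto simp: fun_eq_iff quotient_space3_simps coset_hom coset_rep lookup_const3_mult)
    show "C = \<zero>\<^bsub>quotient_space3 ?I\<^esub>" if "?E C = 0"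
    proof -
      have "rep C \<in> ?I"
      proof (rule order_geI)
        show "Poly_Mapping.lookup (rep C) k = 0" if "tdeg k < r" for k
          using fun_cong[OF \<open>?E C = 0\<close>, of k] that by simp
      qed
      then have "coset (rep C) = coset 0" by (simp add: coset_eq_iff)
      then show ?thesis using C' by (simp add: coset_rep coset_hom quotient_space3_simps)
    qed
    assume "D \<in> carrier (quotient_space3 ?I)"
    then have D': "D \<in> carrier Q" by (simp add: quotient_space3_simps)
    show "?E (C \<oplus>\<^bsub>quotient_space3 ?I\<^esub> D) = ?E C + ?E D"
      using lookup_rep[of _ "rep C + rep D"] C' D'
      by (auto simp: fun_eq_iff quotient_space3_simps coset_hom coset_rep lookup_add)
  next
    show "?E ` carrier (quotient_space3 ?I) \<subseteq> fspace (\<Union>n<r. degree_slice n)"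
      by (auto simp: fspace_def degree_slice_def)
    show "finite (\<Union>n<r. degree_slice n)" using degree_slice(1) by blast
  qed
qed

text \<open>This makes \<open>exists_generators\<close> available for every ideal of finite
  colength, with \<open>r\<close> taken to be the colength.\<close>

lemma less_choose_three: "n < (n + 3) choose 3"
proof (induction n)
  case (Suc n)
  have "0 < (n + 3) choose 2" by simp
  then show ?case using Suc by (simp add: numeral_3_eq_3 numeral_2_eq_2)
qed simp

text \<open>
  Every linear map from the forms of degree \<open>r + 1\<close> to the forms of degree \<open>r\<close> gives a tangent vector,
  since the latter are annihilated by the variables modulo the ideal.
\<close>

lemma dim_tangent_space3_max_ideal3_power:
  assumes inf: "infinite (UNIV :: 'k::field set)"
  shows "((r + 3) choose 2) * ((r + 2) choose 2) \<le>
    vectorspace.dim class_ring (tangent_space3 (max_ideal3_power (Suc r) :: 'k poly3 set))"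
proof -
  let ?I = "order_ge (Suc r) :: 'k poly3 set"
  let ?A = "degree_slice (Suc r)" and ?A' = "degree_slice r"
  interpret poly3_ideal ?I by (rule poly3_ideal.intro[OF ideal_order_ge])
  obtain B :: "'k poly3 set set" and coords e where B: "finite_colength ?I B coords e"
    using exists_finite_colength fin_dim_quotient_order_ge by blast
  \<comment> \<open>The generators serve only to identify the tangent space with cocycles.\<close>
  obtain g s where g: "finite_colength_generators ?I B coords e g s"
    using finite_colength.exists_generators[OF B inf less_choose_three] by blast
  interpret finite_colength_ideal ?I B coords e g s
    unfolding finite_colength_ideal_def using g poly3_ideal_axioms by simp
  \<comment> \<open>\<open>w\<close> is the matrix of a linear map from forms of degree
    \<open>r + 1\<close> to forms of degree \<open>r\<close>; \<open>p w\<close> extends this map by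
    0 to all other degrees.\<close>
  define p where "p w f = (\<Sum>\<beta>\<in>?A'. Poly_Mapping.single \<beta> (\<Sum>\<alpha>\<in>?A. w (\<alpha>, \<beta>) * Poly_Mapping.lookup f \<alpha>))"
    for w :: "_ \<Rightarrow> 'k" and f :: "'k poly3"
  have lookup_p: "Poly_Mapping.lookup (p w f) \<beta> =
    (if \<beta> \<in> ?A' then \<Sum>\<alpha>\<in>?A. w (\<alpha>, \<beta>) * Poly_Mapping.lookup f \<alpha> else 0)" for w f \<beta>
    using degree_slice(1)[of r] by (simp add: p_def lookup_sum lookup_single when_def)
  have p_order: "p w f \<in> order_ge r" for w f
    by (auto simp: order_ge_def lookup_p degree_slice_def split: if_splits)
  have p_add: "p w (f + h) = p w f + p w h" "p (w + w') f = p w f + p w' f" for w w' f h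
    by (rule poly_mapping_eqI; simp add: lookup_p lookup_add distrib_left distrib_right sum.distrib)+
  have p_scale: "p w (const3 c * f) = const3 c * p w f" "p (fscale c w) f = const3 c * p w f" for w c f
    by (rule poly_mapping_eqI; simp add: lookup_p lookup_const3_mult sum_distrib_left mult.assoc mult.left_commute)+
  have p_mult: "coords (p w (h * f)) = coords (h * p w f)" if f: "f \<in> ?I" for w f h
  proof -
    \<comment> \<open>The constant term of \<open>h\<close> acts by scalars. The rest
      \<open>h'\<close> raises the order, so \<open>p w\<close> kills \<open>h' * f\<close>, while
      \<open>h' * p w f\<close> lies in the ideal.\<close>
    define h' where "h' = h - const3 (Poly_Mapping.lookup h 0)"
    have h: "h = const3 (Poly_Mapping.lookup h 0) + h'" by (simp add: h'_def)
    have "Poly_Mapping.lookup h' k = 0" if "tdeg k = 0" for k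
      using that by (simp add: h'_def tdeg_eq_0_iff lookup_minus const3_def)
    then have h': "h' \<in> order_ge 1" unfolding order_ge_def by (auto simp: Suc_le_eq intro: gr0I)
    have "h' * f \<in> order_ge (1 + Suc r)" by (rule order_ge_mult[OF h' f])
    then have "Poly_Mapping.lookup (h' * f) \<alpha> = 0" if "\<alpha> \<in> ?A" for \<alpha>
      using that by (intro order_geD) (auto simp: degree_slice_def)
    then have "p w (h' * f) = 0"
      by (intro poly_mapping_eqI) (simp add: lookup_p)
    moreover have "h' * p w f \<in> ?I" using order_ge_mult[OF h' p_order] by simp
    ultimately show ?thesis
      by (subst (1 2) h) (simp add: distrib_right p_add p_scale coords_add coords_eq_0_iff[THEN iffD2])
  qed
  define \<Phi> where "\<Phi> w f = coords (p w f)" for w f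
  have tangent: "tangent (\<Phi> w)" for w
    unfolding tangent_def \<Phi>_def
    by (auto simp: coords_in p_add p_scale coords_add coords_scale p_mult mapply_mult_matrix)
  have lin: "Vector_Spaces.linear fscale fscale (\<lambda>w. cocycle_of (\<Phi> w))"
  proof (rule fs_linearI)
    show "cocycle_of (\<Phi> (u + v)) = cocycle_of (\<Phi> u) + cocycle_of (\<Phi> v)" for u v
      unfolding cocycle_of_add[symmetric] by (simp add: \<Phi>_def p_add coords_add fun_eq_iff cong: cocycle_of_cong)
    show "cocycle_of (\<Phi> (fscale c u)) = fscale c (cocycle_of (\<Phi> u))" for c u
      unfolding cocycle_of_scale[symmetric] by (simp add: \<Phi>_def p_scale coords_scale fun_eq_iff cong: cocycle_of_cong)
  qed
  have "fs.dim (fspace (?A \<times> ?A') :: (_ \<Rightarrow> 'k) set) \<le> fs.dim (cocycle_of ` Collect tangent)"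
  proof (rule fs_dim_le_inj[OF lin subspace_fspace])
    fix w :: "_ \<Rightarrow> 'k" assume w: "w \<in> fspace (?A \<times> ?A')" and 0: "cocycle_of (\<Phi> w) = 0"
    \<comment> \<open>Testing on the monomials of degree \<open>r + 1\<close> recovers
      \<open>w\<close>: the values have degree \<open>r\<close> and survive in the quotient.\<close>
    have "w (\<alpha>, \<beta>) = 0" if ab: "\<alpha> \<in> ?A" "\<beta> \<in> ?A'" for \<alpha> \<beta>
    proof -
      have "Poly_Mapping.single \<alpha> 1 \<in> ?I" using ab(1) by (intro order_ge_single) (simp add: degree_slice_def)
      then have "\<Phi> w (Poly_Mapping.single \<alpha> 1) = 0" by (rule cocycle_of_inj[OF tangent 0])
      then have "p w (Poly_Mapping.single \<alpha> 1) \<in> ?I" by (simp add: \<Phi>_def coords_eq_0_iff)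
      then have "Poly_Mapping.lookup (p w (Poly_Mapping.single \<alpha> 1)) \<beta> = 0"
        by (rule order_geD) (use ab(2) in \<open>simp add: degree_slice_def\<close>)
      then show ?thesis
        using ab degree_slice(1)[of "Suc r"] by (simp add: lookup_p lookup_single when_def if_distrib cong: if_cong)
    qed
    then show "w = 0" by (intro fspace_eq_0I[OF w]) auto
  next
    show "cocycle_of ` Collect tangent \<subseteq> fspace ({..<3} \<times> B \<times> B)" using cocycle_of_in by blast
  qed (use tangent finite_B in auto)
  then show ?thesis
    unfolding max_ideal3_power_eq dim_tangent_space3
    by (simp add: dim_fspace degree_slice card_cartesian_product numeral_3_eq_3)
qed

section \<open>The upper bound and the final comparison\<close>

lemma dim_tangent_space3_le_multiple:
  fixes I :: "'k::field poly3 set"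
  assumes inf: "infinite (UNIV :: 'k set)" and I: "I \<in> Hilb3 d" and d: "d < (r + 3) choose 3"
  shows "vectorspace.dim class_ring (tangent_space3 I) \<le> (2 * r + 1) * d"
proof -
  interpret poly3_ideal I by (rule poly3_ideal.intro) (use I in \<open>simp add: Hilb3_def\<close>)
  obtain B :: "'k poly3 set set" and coords e where B: "finite_colength I B coords e" "card B = d"
    using exists_finite_colength I by (auto simp: Hilb3_def)
  obtain g s where g: "s \<le> r" "finite_colength_generators I B coords e g s"
    using finite_colength.exists_generators[OF B(1) inf] d B(2) by blast
  interpret finite_colength_ideal I B coords e g s
    unfolding finite_colength_ideal_def using g poly3_ideal_axioms by simp
  have "vectorspace.dim class_ring (tangent_space3 I) \<le> (2 * s + 1) * card B"
    by (rule dim_tangent_space3_le)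
  also have "\<dots> \<le> (2 * r + 1) * d" using g(1) B(2) by simp
  finally show ?thesis .
qed

theorem theorem4p2:
  fixes d r :: nat and I :: "'k::field poly3 set"
  assumes "infinite (UNIV :: 'k set)"
    and "d \<le> (r + 2) choose 3"
    and "I \<in> Hilb3 d"
  shows "real (vectorspace.dim class_ring (tangent_space3 I))
      \<le> 4 / 3 * real (vectorspace.dim class_ring
                        (tangent_space3 (max_ideal3_power r :: 'k poly3 set)))"
proof -
  \<comment> \<open>Pascal's rule makes \<open>(r + 3) choose 3\<close> exceed
    \<open>(r + 2) choose 3\<close>, so the upper bound applies with this \<open>r\<close>.\<close>
  have choose: "(r + 3) choose 3 = ((r + 2) choose 3) + ((r + 2) choose 2)"
    by (simp add: numeral_3_eq_3 numeral_2_eq_2)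
  moreover have "0 < (r + 2) choose 2" by simp
  ultimately have "d < (r + 3) choose 3" using assms(2) by linarith
  then have T: "vectorspace.dim class_ring (tangent_space3 I) \<le> (2 * r + 1) * d"
    using dim_tangent_space3_le_multiple assms by blast
  show ?thesis
  proof (cases r)
    case 0
    \<comment> \<open>\<open>2 choose 3\<close> is 0, so the subscheme is empty and \<open>T\<close>
      bounds its tangent space by 0.\<close>
    then have "d = 0" using assms(2) by (simp add: numeral_3_eq_3)
    then show ?thesis using T by simp
  next
    case (Suc n)
    let ?D = "vectorspace.dim class_ring (tangent_space3 (max_ideal3_power r :: 'k poly3 set))"
    have two: "2 * ((m + 2) choose 2) = (m + 2) * (m + 1)" for m :: nat
      by (induction m) (simp_all add: numeral_2_eq_2 algebra_simps)
    have three: "6 * ((m + 2) choose 3) = (m + 2) * (m + 1) * m" for m :: nat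
    proof (induction m)
      case (Suc m)
      have "(Suc m + 2) choose 3 = ((m + 2) choose 3) + ((m + 2) choose 2)"
        by (simp add: numeral_3_eq_3 numeral_2_eq_2)
      then have "6 * ((Suc m + 2) choose 3) = 6 * ((m + 2) choose 3) + 3 * (2 * ((m + 2) choose 2))" by simp
      then show ?case unfolding Suc two by (simp add: algebra_simps)
    qed simp
    have lower: "((n + 3) choose 2) * ((n + 2) choose 2) \<le> ?D"
      using dim_tangent_space3_max_ideal3_power[OF assms(1), of n] Suc by simp
    have "6 * d \<le> 6 * ((r + 2) choose 3)" using assms(2) by simp
    also have "\<dots> = (r + 2) * (r + 1) * r" by (rule three)
    also have "\<dots> = (n + 3) * (n + 2) * (n + 1)" using Suc by (simp add: algebra_simps)
    finally have 6: "6 * d \<le> (n + 3) * (n + 2) * (n + 1)" .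
    have two': "2 * ((n + 3) choose 2) = (n + 3) * (n + 2)"
      using two[of "n + 1"] by (simp add: numeral_3_eq_3)
    \<comment> \<open>The factor \<open>2 r + 1 = 2 n + 3\<close> is rounded up to
      \<open>2 (n + 2)\<close>. The product is then 8 times the lower bound for \<open>?D\<close>,
      and dividing by 6 produces the constant \<open>4 / 3\<close>.\<close>
    have "(2 * n + 3) * (6 * d) \<le> (2 * n + 4) * ((n + 3) * (n + 2) * (n + 1))"
      by (rule mult_le_mono[OF _ 6]) simp
    also have "\<dots> = 2 * ((2 * ((n + 3) choose 2)) * (2 * ((n + 2) choose 2)))"
      unfolding two[of n] two' by (simp add: algebra_simps)
    also have "\<dots> \<le> 8 * ?D" using lower by simp
    finally have "3 * ((2 * r + 1) * d) \<le> 4 * ?D" using Suc by (simp add: algebra_simps)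
    then have "3 * vectorspace.dim class_ring (tangent_space3 I) \<le> 4 * ?D" using T by linarith
    then have "real (3 * vectorspace.dim class_ring (tangent_space3 I)) \<le> real (4 * ?D)"
      by (rule of_nat_mono)
    then show ?thesis by simp
  qed
qed

end
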